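(* Let $\alpha\ge-1$, $n$ a positive integer, $\psi_0,\psi_n$ analytic on $\mathbb D$ and $\varphi_0,\varphi_n$ analytic self-maps of $\mathbb D$ such that $C_{\psi_0,\varphi_0}$ and $D_{\psi_n,\varphi_n,n}$ are bounded on $\mathcal H_\alpha$. Suppose $w\in\mathbb D$ satisfies $\varphi_0(w)=\varphi_n(w)=w$ and $\psi_n$ has a zero at $w$ of order at least $n$. If $C_{\psi_0,\varphi_0}+D_{\psi_n,\varphi_n,n}$ is compact on $\mathcal H_\alpha$, then $$\sigma_\alpha(C_{\psi_0,\varphi_0}+D_{\psi_n,\varphi_n,n})=\{0\}\cup\{\psi_0(w)\}\cup\{\psi_0(w)(\varphi_0'(w))^l:\ 1\le l\le n-1\}\cup\Big\{\psi_0(w)(\varphi_0'(w))^l+\binom{l}{n}\psi_n^{(n)}(w)(\varphi_n'(w))^{l-n}:\ l\ge n\Big\}.$$ In particular, if $D_{\psi_n,\varphi_n,n}$ is compact on $\mathcal H_\alpha$, $\varphi_n(w)=w\in\mathbb D$, and $\psi_n^{(j)}(w)=0$ for all $0\le j\le n$, then $D_{\psi_n,\varphi_n,n}$ is quasinilpotent, i.e. $\sigma_\alpha(D_{\psi_n,\varphi_n,n})=\{0\}$.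
   Context: For $\alpha=-1$, $\mathcal H_\alpha$ denotes the Hardy space $H^2$ on the open unit disk $\mathbb D$; for $\alpha>-1$, $\mathcal H_\alpha$ denotes the weighted Bergman space $A^2_\alpha$ of analytic $f$ on $\mathbb D$ with $\int_{\mathbb D}|f(z)|^2(\alpha+1)(1-|z|^2)^\alpha\,dA(z)<\infty$, $dA$ normalized area measure. For $\psi$ analytic on $\mathbb D$, $\varphi$ an analytic self-map of $\mathbb D$ and $n$ a positive integer: $C_{\psi,\varphi}f=\psi\cdot(f\circ\varphi)$ and $D_{\psi,\varphi,n}f=\psi\cdot(f^{(n)}\circ\varphi)$. $\sigma_\alpha(T)$ denotes the spectrum of $T$ on $\mathcal H_\alpha$. A function $\psi$ has a zero at $w$ of order at least $k$ if $\psi^{(j)}(w)=0$ for $0\le j\le k-1$. Convention: $0^0=1$. *)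

theory Defs
  imports "HOL-Analysis.Analysis"
begin

definition circ_mean2 :: "(complex \<Rightarrow> complex) \<Rightarrow> real \<Rightarrow> real" where
  "circ_mean2 f r = integral {0..2*pi} (\<lambda>t. (cmod (f (of_real r * cis t)))^2) / (2*pi)"

text \<open>Weighted Bergman density, with dA = normalized area measure (Lebesgue / pi).\<close>
definition berg_dens :: "real \<Rightarrow> (complex \<Rightarrow> complex) \<Rightarrow> complex \<Rightarrow> real" where
  "berg_dens \<alpha> f z = (cmod (f z))^2 * (\<alpha> + 1) * (1 - (cmod z)^2) powr \<alpha> / pi"

text \<open>H_alpha: Hardy space H^2 for alpha = -1, weighted Bergman space A^2_alpha for alpha > -1.\<close>
definition Hspace :: "real \<Rightarrow> (complex \<Rightarrow> complex) set" where
  "Hspace \<alpha> = {f. f holomorphic_on ball 0 1 \<and>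
     (if \<alpha> = -1 then bdd_above (circ_mean2 f ` {0<..<1})
      else berg_dens \<alpha> f integrable_on ball 0 1)}"

definition Hnorm :: "real \<Rightarrow> (complex \<Rightarrow> complex) \<Rightarrow> real" where
  "Hnorm \<alpha> f = sqrt (if \<alpha> = -1 then (SUP r\<in>{0<..<1}. circ_mean2 f r)
                      else integral (ball 0 1) (berg_dens \<alpha> f))"

text \<open>Bounded linear operator on H_alpha (functions identified on the disk).\<close>
definition bounded_op :: "real \<Rightarrow> ((complex \<Rightarrow> complex) \<Rightarrow> (complex \<Rightarrow> complex)) \<Rightarrow> bool" where
  "bounded_op \<alpha> T \<longleftrightarrow>
     (\<forall>f\<in>Hspace \<alpha>. T f \<in> Hspace \<alpha>) \<and>
     (\<forall>f\<in>Hspace \<alpha>. \<forall>g\<in>Hspace \<alpha>. \<forall>c. \<forall>z\<in>ball 0 1.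
        T (\<lambda>x. f x + c * g x) z = T f z + c * T g z) \<and>
     (\<exists>C. \<forall>f\<in>Hspace \<alpha>. Hnorm \<alpha> (T f) \<le> C * Hnorm \<alpha> f)"

definition compact_op :: "real \<Rightarrow> ((complex \<Rightarrow> complex) \<Rightarrow> (complex \<Rightarrow> complex)) \<Rightarrow> bool" where
  "compact_op \<alpha> T \<longleftrightarrow> bounded_op \<alpha> T \<and>
     (\<forall>u :: nat \<Rightarrow> complex \<Rightarrow> complex. (\<forall>k. u k \<in> Hspace \<alpha>) \<and> (\<exists>B. \<forall>k. Hnorm \<alpha> (u k) \<le> B) \<longrightarrow>
        (\<exists>r g. strict_mono r \<and> g \<in> Hspace \<alpha> \<and>
           (\<lambda>k. Hnorm \<alpha> (\<lambda>z. T (u (r k)) z - g z)) \<longlonglongrightarrow> 0))"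

definition spec :: "real \<Rightarrow> ((complex \<Rightarrow> complex) \<Rightarrow> (complex \<Rightarrow> complex)) \<Rightarrow> complex set" where
  "spec \<alpha> T = {\<mu>. \<not> (\<exists>S. bounded_op \<alpha> S \<and>
       (\<forall>f\<in>Hspace \<alpha>. \<forall>z\<in>ball 0 1. S (\<lambda>x. T f x - \<mu> * f x) z = f z) \<and>
       (\<forall>g\<in>Hspace \<alpha>. \<forall>z\<in>ball 0 1. T (S g) z - \<mu> * S g z = g z))}"

definition Cop :: "(complex \<Rightarrow> complex) \<Rightarrow> (complex \<Rightarrow> complex) \<Rightarrow> (complex \<Rightarrow> complex) \<Rightarrow> (complex \<Rightarrow> complex)" where
  "Cop \<psi> \<phi> f = (\<lambda>z. \<psi> z * f (\<phi> z))"

definition Dop :: "(complex \<Rightarrow> complex) \<Rightarrow> (complex \<Rightarrow> complex) \<Rightarrow> nat \<Rightarrow> (complex \<Rightarrow> complex) \<Rightarrow> (complex \<Rightarrow> complex)" where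
  "Dop \<psi> \<phi> n f = (\<lambda>z. \<psi> z * (deriv ^^ n) f (\<phi> z))"

definition self_map :: "(complex \<Rightarrow> complex) \<Rightarrow> bool" where
  "self_map \<phi> \<longleftrightarrow> \<phi> holomorphic_on ball 0 1 \<and> \<phi> ` ball 0 1 \<subseteq> ball 0 1"

end

theory Submission
  imports Defs "HOL-Complex_Analysis.Complex_Analysis" "HOL-Library.Function_Algebras"
begin

text \<open>Order functions by their vanishing order at \<open>w\<close>. The operator \<open>T\<close> maps
a function with leading term \<open>c (z - w)\<^sup>l\<close> to one with leading term \<open>\<lambda>\<^sub>l c (z - w)\<^sup>l\<close>, where
\<open>\<lambda>\<^sub>l\<close> is the \<open>l\<close>-th number on the right-hand side: it is lower triangular with diagonal
\<open>(\<lambda>\<^sub>l)\<close>. If \<open>l\<close> is minimal with \<open>\<lambda>\<^sub>l = \<mu>\<close>, then \<open>(z - w)\<^sup>l\<close> is not in the range of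
\<open>T - \<mu>\<close>; if \<open>\<mu>\<close> differs from all \<open>\<lambda>\<^sub>l\<close>, then \<open>T - \<mu>\<close> is injective. For \<open>\<mu> \<noteq> 0\<close> the Fredholm
alternative turns injectivity into invertibility, and \<open>0\<close> is in the spectrum because the space is
infinite-dimensional. The quasinilpotent case is the case \<open>\<psi>\<^sub>0 = 0\<close>.\<close>

section \<open>The Fredholm alternative for compact operators\<close>

text \<open>The zero of \<open>\<psi>n\<close> is what makes \<open>T\<close> triangular: n
  derivatives lower the vanishing order by n, and \<open>\<psi>n\<close> restores it. For l < n its
  contribution has order at least n > l, so the l-th diagonal entry comes from \<open>Cop\<close>
  alone. The factor l!/(l-n)! from differentiation and the 1/n! in the Taylor coefficient of
  \<open>\<psi>n\<close> combine to the binomial coefficient. Minimality of l permits cancellation: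
  if \<open>(T - \<mu>) f = (z - w)^l\<close>, the nonzero differences
  \<open>eigenval k - \<mu>\<close> for k < l force f to vanish to order l, and then the
  coefficients of order l give 0 = 1. The obstacle is that the spaces are sets of functions,
  identified only on the disk, and not types. The Fredholm alternative is therefore proved for a
  carrier set, with limits drawn from the sequential compactness of \<open>T\<close>.\<close>

lemma null_seq_mono:
  fixes f g :: "nat \<Rightarrow> real"
  assumes "g \<longlonglongrightarrow> 0" "\<And>k. 0 \<le> f k" "\<And>k. f k \<le> g k"
  shows "f \<longlonglongrightarrow> 0"
  using assms by (intro tendsto_sandwich[of "\<lambda>_. 0" f sequentially g]) auto

text \<open>The norm axioms are relative to \<open>H\<close> because \<open>Hnorm\<close> takes
  default values outside \<open>Hspace\<close>: for \<open>\<alpha> > -1\<close> a non-integrable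
  density has integral 0, hence norm 0.\<close>

locale normed_carrier = vector_space scale
  for scale :: "complex \<Rightarrow> 'a::ab_group_add \<Rightarrow> 'a" (infixr \<open>\<odot>\<close> 75) +
  fixes H :: "'a set" and N :: "'a \<Rightarrow> real"
  assumes subspace_H: "subspace H"
    and N_triangle: "x \<in> H \<Longrightarrow> y \<in> H \<Longrightarrow> N (x + y) \<le> N x + N y"
    and N_scale: "x \<in> H \<Longrightarrow> N (c \<odot> x) = cmod c * N x"
    and N_eq_0: "x \<in> H \<Longrightarrow> N x = 0 \<Longrightarrow> x = 0"
begin

lemmas H_intros = subspace_add[OF subspace_H] subspace_diff[OF subspace_H]
  subspace_scale[OF subspace_H] subspace_0[OF subspace_H]

lemma N_0: "N 0 = 0"
  using N_scale[of 0 0] H_intros by simp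

lemma N_minus_commute: "x \<in> H \<Longrightarrow> y \<in> H \<Longrightarrow> N (x - y) = N (y - x)"
  using N_scale[of "y - x" "-1"] H_intros by (simp add: scale_right_diff_distrib)

lemma N_nonneg: "x \<in> H \<Longrightarrow> 0 \<le> N x"
  using N_triangle[of x "- x"] N_scale[of x "-1"] N_0 H_intros(3)[of x "-1"] by simp

lemma N_triangle_diff: "x \<in> H \<Longrightarrow> y \<in> H \<Longrightarrow> z \<in> H \<Longrightarrow> N (x - z) \<le> N (x - y) + N (y - z)"
  using N_triangle[of "x - y" "y - z"] H_intros by simp

lemma N_diff_le: "x \<in> H \<Longrightarrow> y \<in> H \<Longrightarrow> N (x - y) \<le> N x + N y"
  using N_triangle_diff[of x 0 y] N_minus_commute[of 0 y] H_intros by simp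

text \<open>Closedness relative to \<open>H\<close>, phrased by approximation, since
  \<open>N\<close> is an arbitrary function and carries no topology of its own.\<close>

definition nclosed :: "'a set \<Rightarrow> bool" where
  "nclosed Y \<longleftrightarrow> (\<forall>x\<in>H. (\<forall>e>0. \<exists>y\<in>Y. N (x - y) < e) \<longrightarrow> x \<in> Y)"

lemma nclosed_dist_pos:
  assumes "nclosed Y" "x \<in> H" "x \<notin> Y"
  obtains d where "d > 0" "\<And>y. y \<in> Y \<Longrightarrow> d \<le> N (x - y)"
  using assms unfolding nclosed_def by (meson not_less)

text \<open>Take a point z of \<open>Z\<close> outside \<open>Y\<close>, subtract an almost nearest
  point of \<open>Y\<close> and normalise. Distances to the subspace \<open>Y\<close> scale along,
  so they stay close to 1.\<close>

lemma riesz_lemma: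
  assumes Y: "subspace Y" "nclosed Y" and Z: "subspace Z" "Z \<subseteq> H" "Y \<subseteq> Z" "\<not> Z \<subseteq> Y"
  obtains x where "x \<in> Z" "N x = 1" "\<And>y. y \<in> Y \<Longrightarrow> 1/2 \<le> N (x - y)"
proof -
  obtain z where z: "z \<in> Z" "z \<notin> Y" using Z by blast
  obtain d0 where d0: "d0 > 0" "\<And>y. y \<in> Y \<Longrightarrow> d0 \<le> N (z - y)"
    using nclosed_dist_pos[of Y z] Y z Z by blast
  define d where "d = (INF y\<in>Y. N (z - y))"
  have ne: "Y \<noteq> {}" using Y(1) subspace_0 by blast
  have bdd: "bdd_below ((\<lambda>y. N (z - y)) ` Y)" using d0(2) by (meson bdd_below.I2)
  have dpos: "d \<ge> d0" unfolding d_def using ne d0 by (intro cINF_greatest)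
  have dle: "d \<le> N (z - y)" if "y \<in> Y" for y unfolding d_def using bdd that by (rule cINF_lower)
  \<comment> \<open>Approximating the distance d up to a factor 2 is the source of the 1/2: after
    division by s < 2d, distances at least d become at least 1/2.\<close>
  have "d < 2 * d" using dpos d0 by simp
  then obtain y0 where y0: "y0 \<in> Y" "N (z - y0) < 2 * d"
    unfolding d_def using ne bdd by (auto simp: cINF_less_iff)
  define s where "s = N (z - y0)"
  have s: "s > 0" "s < 2 * d" using y0 d0 dle[OF y0(1)] dpos unfolding s_def by auto
  have zy: "z - y0 \<in> Z" using z y0 Z subspace_diff by blast
  define x where "x = of_real (1/s) \<odot> (z - y0)"
  show ?thesis
  proof
    show "x \<in> Z" unfolding x_def using zy Z subspace_scale by blast
    have "N x = cmod (of_real (1/s)) * s" unfolding x_def s_def using zy Z by (intro N_scale) blast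
    then show "N x = 1" using s by (simp add: norm_divide)
    fix y assume y: "y \<in> Y"
    have y': "y0 + of_real s \<odot> y \<in> Y" using y y0 Y subspace_add subspace_scale by blast
    have "x - y = of_real (1/s) \<odot> (z - (y0 + of_real s \<odot> y))"
      unfolding x_def using s by (simp add: scale_right_diff_distrib scale_right_distrib)
    moreover have "z - (y0 + of_real s \<odot> y) \<in> H" using y' z Z H_intros(2) by blast
    ultimately have "N (x - y) = cmod (of_real (1/s)) * N (z - (y0 + of_real s \<odot> y))"
      using N_scale by metis
    then have "N (x - y) = (1/s) * N (z - (y0 + of_real s \<odot> y))"
      using s by (simp add: norm_divide)
    moreover have "d \<le> N (z - (y0 + of_real s \<odot> y))" using dle y' by blast
    ultimately have "(1/s) * d \<le> N (x - y)" using s by (simp add: divide_right_mono)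
    moreover have "1/2 \<le> (1/s) * d" using s by (simp add: field_simps)
    ultimately show "1/2 \<le> N (x - y)" by linarith
  qed
qed

lemma nclosed_zero: "nclosed {0}"
  unfolding nclosed_def
proof (intro ballI impI)
  fix x assume x: "x \<in> H" and *: "\<forall>e>0. \<exists>y\<in>{0}. N (x - y) < e"
  then have "\<forall>e>0. N x < e" by simp
  then have "N x \<le> 0" by (meson less_irrefl not_le)
  then show "x \<in> {0}" using N_nonneg[OF x] N_eq_0[OF x] by auto
qed

text \<open>The set is the span of \<open>Y\<close> and \<open>v\<close>, in the shape of
  \<open>span_insert\<close>. Since \<open>v\<close> has positive distance d from \<open>Y\<close>,
  the coefficient k of \<open>v\<close> satisfies |k| d <= N(y + k v). Coefficients of an
  approximating sequence are thus Cauchy, and their limit in the complex numbers places the limit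
  point in the set.\<close>

lemma nclosed_span_insert:
  assumes v: "v \<in> H" and Y: "subspace Y" "nclosed Y" "Y \<subseteq> H" "v \<notin> Y"
  shows "nclosed {x. \<exists>k. x - k \<odot> v \<in> Y}" (is "nclosed ?Z")
  unfolding nclosed_def
proof (intro ballI impI)
  fix x assume x: "x \<in> H" and app: "\<forall>e>0. \<exists>y\<in>?Z. N (x - y) < e"
  obtain d where d: "d > 0" "\<And>y. y \<in> Y \<Longrightarrow> d \<le> N (v - y)"
    using nclosed_dist_pos[of Y v] Y v by blast
  have low: "cmod k * d \<le> N (y + k \<odot> v)" if y: "y \<in> Y" for y k
  proof (cases "k = 0")
    case True
    have "y \<in> H" using y Y by blast
    then show ?thesis using True N_nonneg by simp
  next
    case False
    have e: "y + k \<odot> v = k \<odot> (v - (- inverse k) \<odot> y)"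
      using False by (simp add: scale_right_diff_distrib scale_right_distrib)
    have y': "(- inverse k) \<odot> y \<in> Y" using y Y subspace_scale by blast
    have "N (y + k \<odot> v) = cmod k * N (v - (- inverse k) \<odot> y)"
      unfolding e using y' Y v H_intros by (intro N_scale) blast
    then show ?thesis using d(2)[OF y'] by (simp add: mult_left_mono)
  qed
  have "\<forall>n::nat. \<exists>y\<in>?Z. N (x - y) < inverse (real (Suc n))" using app by simp
  then obtain z where z: "\<And>n::nat. z n \<in> ?Z" "\<And>n. N (x - z n) < inverse (real (Suc n))" by metis
  then have "\<forall>n. \<exists>c. z n - c \<odot> v \<in> Y" by blast
  then obtain k where k: "\<And>n. z n - k n \<odot> v \<in> Y" by metis
  have zH: "z n \<in> H" for n
  proof -
    have "(z n - k n \<odot> v) + k n \<odot> v \<in> H"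
      using k[of n] Y(3) v by (intro H_intros(1) H_intros(3)[OF v]) blast
    then show ?thesis by simp
  qed
  have kd: "cmod (k m - k n) * d \<le> inverse (real (Suc m)) + inverse (real (Suc n))" for m n
  proof -
    have "cmod (k m - k n) * d \<le> N (((z m - k m \<odot> v) - (z n - k n \<odot> v)) + (k m - k n) \<odot> v)"
      using k Y subspace_diff by (intro low) blast
    also have "\<dots> = N (z m - z n)" by (simp add: scale_left_diff_distrib algebra_simps)
    also have "\<dots> \<le> N (z m - x) + N (x - z n)" using N_triangle_diff zH x by blast
    also have "\<dots> \<le> inverse (real (Suc m)) + inverse (real (Suc n))"
      using z(2)[of m] z(2)[of n] N_minus_commute[OF x zH] by (simp add: less_imp_le add_mono)
    finally show ?thesis .
  qed
  have "Cauchy k"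
  proof (rule metric_CauchyI)
    fix e :: real assume e: "e > 0"
    obtain M where M: "inverse (real (Suc M)) < e * d / 2" using reals_Archimedean[of "e*d/2"] e d by auto
    have "dist (k m) (k n) < e" if "m \<ge> M" "n \<ge> M" for m n
    proof -
      have "inverse (real (Suc m)) \<le> inverse (real (Suc M))" "inverse (real (Suc n)) \<le> inverse (real (Suc M))"
        using that by (auto simp: field_simps)
      then have "cmod (k m - k n) * d < e * d" using kd[of m n] M by linarith
      then show ?thesis using d by (simp add: dist_norm)
    qed
    then show "\<exists>M. \<forall>m\<ge>M. \<forall>n\<ge>M. dist (k m) (k n) < e" by blast
  qed
  then obtain l where l: "k \<longlonglongrightarrow> l" using Cauchy_convergent convergent_def by blast
  have "x - l \<odot> v \<in> Y"
  proof -
    have "\<exists>y\<in>Y. N (x - l \<odot> v - y) < e" if e: "e > 0" for e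
    proof -
      have "(\<lambda>n. inverse (real (Suc n)) + cmod (k n - l) * N v) \<longlonglongrightarrow> 0 + cmod (l - l) * N v"
        by (intro tendsto_intros l LIMSEQ_inverse_real_of_nat)
      then have "\<forall>\<^sub>F n in sequentially. inverse (real (Suc n)) + cmod (k n - l) * N v < e"
        using e by (intro order_tendstoD) auto
      then obtain n where n: "inverse (real (Suc n)) + cmod (k n - l) * N v < e"
        by (meson eventually_sequentially order_refl)
      have "N (x - l \<odot> v - (z n - k n \<odot> v)) = N ((x - z n) + (k n - l) \<odot> v)"
        by (simp add: scale_left_diff_distrib algebra_simps)
      also have "\<dots> \<le> N (x - z n) + cmod (k n - l) * N v"
        using N_triangle[of "x - z n" "(k n - l) \<odot> v"] N_scale[OF v] H_intros x zH v by simp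
      finally show ?thesis using n z(2)[of n] k by (intro bexI[OF _ k[of n]]) linarith
    qed
    then show ?thesis using Y(2) x v H_intros unfolding nclosed_def by auto
  qed
  then show "x \<in> ?Z" by blast
qed

end

section \<open>Compact operators and Riesz sequences\<close>

locale compact_endo = normed_carrier +
  fixes T :: "'a \<Rightarrow> 'a"
  assumes T_in: "x \<in> H \<Longrightarrow> T x \<in> H"
    and T_add: "x \<in> H \<Longrightarrow> y \<in> H \<Longrightarrow> T (x + y) = T x + T y"
    and T_scale: "x \<in> H \<Longrightarrow> T (c \<odot> x) = c \<odot> T x"
    and T_bounded: "\<exists>C. \<forall>x\<in>H. N (T x) \<le> C * N x"
    and T_compact: "\<lbrakk>\<And>k::nat. u k \<in> H; \<And>k. N (u k) \<le> B\<rbrakk> \<Longrightarrow>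
      \<exists>r g. strict_mono r \<and> g \<in> H \<and> (\<lambda>k. N (T (u (r k)) - g)) \<longlonglongrightarrow> 0"
begin

lemma T_diff: "x \<in> H \<Longrightarrow> y \<in> H \<Longrightarrow> T (x - y) = T x - T y"
  using T_add[of "x - y" y] H_intros by simp

text \<open>The contradiction in which both Riesz constructions below end: along a convergent
  subsequence of the images, two terms lie within \<open>d/2\<close> of the limit.\<close>

lemma no_separated_image:
  assumes u: "\<And>k::nat. u k \<in> H" "\<And>k. N (u k) \<le> B" and d: "d > 0"
    and sep: "\<And>k m. k < m \<Longrightarrow> d \<le> N (T (u k) - T (u m))"
  shows False
proof -
  obtain r g where r: "strict_mono r" "g \<in> H" "(\<lambda>k. N (T (u (r k)) - g)) \<longlonglongrightarrow> 0"
    using T_compact[of u B, OF u] by metis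
  have "\<forall>\<^sub>F k in sequentially. N (T (u (r k)) - g) < d / 2"
    using r(3) d by (intro order_tendstoD) auto
  then obtain k where k: "\<And>m. m \<ge> k \<Longrightarrow> N (T (u (r m)) - g) < d / 2"
    by (auto simp: eventually_sequentially)
  have "N (T (u (r k)) - T (u (r (Suc k)))) \<le> N (T (u (r k)) - g) + N (g - T (u (r (Suc k))))"
    using N_triangle_diff u T_in r by blast
  also have "\<dots> < d" using k[of k] k[of "Suc k"] N_minus_commute[of g "T (u (r (Suc k)))"] u T_in r by simp
  finally show False using sep[of "r k" "r (Suc k)"] r(1) by (simp add: strict_mono_def)
qed

text \<open>Serves to put 0 into the spectrum. Riesz's lemma along the nested finite-dimensional
  spans gives unit vectors at mutual distance at least 1/2; a lower bound \<open>c\<close> for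
  \<open>T\<close> would keep their images \<open>c/2\<close> apart.\<close>

lemma infinite_dim_not_bounded_below:
  assumes e: "\<And>k::nat. e k \<in> H" "\<And>k. e k \<notin> span (e ` {..<k})" and c: "c > 0"
  shows "\<exists>x\<in>H. N (T x) < c * N x"
proof (rule ccontr)
  assume "\<not> ?thesis"
  then have low: "c * N x \<le> N (T x)" if "x \<in> H" for x using that by force
  have PH: "span (e ` {..<k}) \<subseteq> H" for k using e subspace_H by (intro span_minimal) auto
  have closed: "nclosed (span (e ` {..<k}))" for k
  proof (induction k)
    case 0 show ?case using nclosed_zero by simp
  next
    case (Suc k)
    have "span (e ` {..<Suc k}) = {x. \<exists>c. x - c \<odot> e k \<in> span (e ` {..<k})}"
      by (simp add: lessThan_Suc span_insert)
    then show ?case using nclosed_span_insert[OF e(1)[of k] subspace_span Suc PH e(2)] by simp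
  qed
  have mono: "span (e ` {..<k}) \<subseteq> span (e ` {..<m})" if "k \<le> m" for k m
    using that by (intro span_mono image_mono) auto
  have "\<exists>x. x \<in> span (e ` {..<Suc k}) \<and> N x = 1 \<and> (\<forall>y\<in>span (e ` {..<k}). 1/2 \<le> N (x - y))" for k
  proof -
    have "e k \<in> span (e ` {..<Suc k})" by (intro span_base) auto
    then have "\<not> span (e ` {..<Suc k}) \<subseteq> span (e ` {..<k})" using e(2) by blast
    then show ?thesis
      using riesz_lemma[OF subspace_span closed[of k] subspace_span PH mono[of k "Suc k"]]
      by (metis Suc_n_not_le_n nat_le_linear)
  qed
  then obtain x where x: "\<And>k. x k \<in> span (e ` {..<Suc k})" "\<And>k. N (x k) = 1"
    "\<And>k y. y \<in> span (e ` {..<k}) \<Longrightarrow> 1/2 \<le> N (x k - y)" by metis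
  have xH: "x k \<in> H" for k using x(1) PH by blast
  show False
  proof (rule no_separated_image[of x 1 "c/2"])
    fix k m :: nat assume "k < m"
    then have "1/2 \<le> N (x m - x k)" using x(1)[of k] mono[of "Suc k" m] by (intro x(3)) auto
    then have "c * (1/2) \<le> c * N (x k - x m)" using c N_minus_commute xH by simp
    also have "\<dots> \<le> N (T (x k) - T (x m))"
      using low[of "x k - x m"] xH H_intros T_diff by simp
    finally show "c/2 \<le> N (T (x k) - T (x m))" by simp
  qed (use x xH c in auto)
qed

definition shift :: "complex \<Rightarrow> 'a \<Rightarrow> 'a" where
  "shift \<mu> x = T x - \<mu> \<odot> x"

section \<open>The operator \<open>T - \<mu>\<close> for nonzero \<open>\<mu>\<close> that is not an
  eigenvalue\<close>

context
  fixes \<mu> :: complex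
  assumes \<mu>: "\<mu> \<noteq> 0" and inj: "\<And>x. x \<in> H \<Longrightarrow> T x = \<mu> \<odot> x \<Longrightarrow> x = 0"
begin

lemma shift_in: "x \<in> H \<Longrightarrow> shift \<mu> x \<in> H"
  and shift_add: "x \<in> H \<Longrightarrow> y \<in> H \<Longrightarrow> shift \<mu> (x + y) = shift \<mu> x + shift \<mu> y"
  and shift_diff: "x \<in> H \<Longrightarrow> y \<in> H \<Longrightarrow> shift \<mu> (x - y) = shift \<mu> x - shift \<mu> y"
  and shift_scale: "x \<in> H \<Longrightarrow> shift \<mu> (c \<odot> x) = c \<odot> shift \<mu> x"
  unfolding shift_def
  by (simp_all add: T_in T_add T_diff T_scale H_intros scale_right_distrib scale_right_diff_distrib
      scale_left_commute[of c])

lemma shift_bounded: obtains C where "C > 0" "\<And>x. x \<in> H \<Longrightarrow> N (shift \<mu> x) \<le> C * N x"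
proof -
  obtain C where C: "\<And>x. x \<in> H \<Longrightarrow> N (T x) \<le> C * N x" using T_bounded by blast
  show ?thesis
  proof
    show "\<bar>C\<bar> + cmod \<mu> > 0" using \<mu> by (intro add_nonneg_pos) auto
    fix x assume x: "x \<in> H"
    have "N (shift \<mu> x) \<le> N (T x) + N (\<mu> \<odot> x)" unfolding shift_def by (intro N_diff_le T_in x H_intros(3))
    also have "\<dots> \<le> C * N x + cmod \<mu> * N x" using C[OF x] N_scale[OF x] by simp
    also have "\<dots> \<le> (\<bar>C\<bar> + cmod \<mu>) * N x" using N_nonneg[OF x] by (simp add: distrib_right mult_right_mono)
    finally show "N (shift \<mu> x) \<le> (\<bar>C\<bar> + cmod \<mu>) * N x" .
  qed
qed

text \<open>Completeness of \<open>H\<close> is not needed: compactness of \<open>T\<close> supplies the limit.\<close>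
lemma convergent_subseq:
  assumes u: "\<And>k::nat. u k \<in> H" "\<And>k. N (u k) \<le> B" and x: "x \<in> H"
    and lim: "(\<lambda>k. N (shift \<mu> (u k) - x)) \<longlonglongrightarrow> 0"
  obtains r y where "strict_mono r" "y \<in> H" "(\<lambda>k. N (u (r k) - y)) \<longlonglongrightarrow> 0" "shift \<mu> y = x"
proof -
  obtain r g where r: "strict_mono r" "g \<in> H" "(\<lambda>k. N (T (u (r k)) - g)) \<longlonglongrightarrow> 0"
    using T_compact[of u B, OF u] by metis
  \<comment> \<open>From \<open>shift \<mu> u = T u - \<mu> u\<close> one gets u as
    \<open>inverse \<mu>\<close> times \<open>T u - shift \<mu> u\<close>. Along the subsequence
    \<open>T u\<close> tends to g and \<open>shift \<mu> u\<close> to x, which dictates this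
    limit.\<close>
  define y where "y = inverse \<mu> \<odot> (g - x)"
  have y: "y \<in> H" unfolding y_def by (intro H_intros(2,3) r x)
  have lim': "(\<lambda>k. N (shift \<mu> (u (r k)) - x)) \<longlonglongrightarrow> 0"
    using LIMSEQ_subseq_LIMSEQ[OF lim r(1)] by (simp add: o_def)
  have b: "N (u (r k) - y) \<le> cmod (inverse \<mu>) * (N (T (u (r k)) - g) + N (shift \<mu> (u (r k)) - x))" for k
  proof -
    have "u (r k) - y = inverse \<mu> \<odot> ((T (u (r k)) - g) - (shift \<mu> (u (r k)) - x))"
      unfolding y_def shift_def using \<mu> by (simp add: algebra_simps scale_right_diff_distrib scale_right_distrib)
    moreover have "(T (u (r k)) - g) - (shift \<mu> (u (r k)) - x) \<in> H"
      by (intro H_intros(2) T_in shift_in u r x)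
    ultimately have "N (u (r k) - y) = cmod (inverse \<mu>) * N ((T (u (r k)) - g) - (shift \<mu> (u (r k)) - x))"
      using N_scale by metis
    also have "\<dots> \<le> cmod (inverse \<mu>) * (N (T (u (r k)) - g) + N (shift \<mu> (u (r k)) - x))"
      by (intro mult_left_mono N_diff_le H_intros(2) T_in shift_in u r x norm_ge_zero)
    finally show ?thesis .
  qed
  have "(\<lambda>k. cmod (inverse \<mu>) * (N (T (u (r k)) - g) + N (shift \<mu> (u (r k)) - x))) \<longlonglongrightarrow> cmod (inverse \<mu>) * (0 + 0)"
    by (intro tendsto_mult tendsto_const tendsto_add r(3) lim')
  then have uy: "(\<lambda>k. N (u (r k) - y)) \<longlonglongrightarrow> 0"
    by (intro null_seq_mono[OF _ N_nonneg b] H_intros(2) u y) simp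
  obtain C where C: "C > 0" "\<And>x. x \<in> H \<Longrightarrow> N (shift \<mu> x) \<le> C * N x" using shift_bounded by metis
  have b2: "N (shift \<mu> y - x) \<le> C * N (u (r k) - y) + N (shift \<mu> (u (r k)) - x)" for k
  proof -
    have "N (shift \<mu> y - x) \<le> N (shift \<mu> y - shift \<mu> (u (r k))) + N (shift \<mu> (u (r k)) - x)"
      by (intro N_triangle_diff shift_in u x y)
    also have "N (shift \<mu> y - shift \<mu> (u (r k))) = N (shift \<mu> (u (r k) - y))"
      using shift_diff N_minus_commute shift_in u y by simp
    also have "\<dots> \<le> C * N (u (r k) - y)" by (intro C(2) H_intros(2) u y)
    finally show ?thesis by simp
  qed
  have "(\<lambda>k. C * N (u (r k) - y) + N (shift \<mu> (u (r k)) - x)) \<longlonglongrightarrow> C * 0 + 0"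
    by (intro tendsto_mult tendsto_const tendsto_add uy lim')
  then have "N (shift \<mu> y - x) \<le> 0" using b2 by (intro LIMSEQ_le_const) auto
  then have "shift \<mu> y - x = 0" by (intro N_eq_0 antisym N_nonneg H_intros(2) shift_in x y)
  then show ?thesis using that r y uy by auto
qed

text \<open>Otherwise there are unit vectors whose images tend to 0. A subsequence converges to a
  kernel vector, which is 0 by injectivity although the norms are 1.\<close>

lemma shift_bounded_below: "\<exists>c>0. \<forall>x\<in>H. c * N x \<le> N (shift \<mu> x)"
proof (rule ccontr)
  assume neg: "\<not> ?thesis"
  have "\<exists>x\<in>H. N x = 1 \<and> N (shift \<mu> x) < inverse (real (Suc k))" for k
  proof -
    obtain x where x: "x \<in> H" "N (shift \<mu> x) < inverse (real (Suc k)) * N x"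
      using neg by (meson inverse_positive_iff_positive not_le of_nat_0_less_iff zero_less_Suc)
    have Nx: "N x > 0" using x N_nonneg[of "shift \<mu> x"] shift_in N_nonneg[OF x(1)] by (cases "N x = 0") auto
    define y where "y = of_real (1 / N x) \<odot> x"
    have "N y = 1" unfolding y_def using N_scale[of x "of_real (1 / N x)"] x Nx by (simp add: norm_divide)
    moreover have "N (shift \<mu> y) = (1 / N x) * N (shift \<mu> x)"
      unfolding y_def using N_scale[of "shift \<mu> x" "of_real (1 / N x)"] shift_in shift_scale x Nx by (simp add: norm_divide)
    moreover have "(1 / N x) * N (shift \<mu> x) < inverse (real (Suc k))" using x(2) Nx by (simp add: field_simps)
    moreover have "y \<in> H" unfolding y_def by (intro H_intros(3) x)
    ultimately show ?thesis by auto
  qed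
  then obtain u where u: "\<And>k. u k \<in> H" "\<And>k. N (u k) = 1" "\<And>k. N (shift \<mu> (u k)) < inverse (real (Suc k))" by metis
  have "(\<lambda>k. N (shift \<mu> (u k) - 0)) \<longlonglongrightarrow> 0"
    using u(3) by (intro null_seq_mono[OF LIMSEQ_inverse_real_of_nat])
      (simp_all add: N_nonneg shift_in u(1) less_imp_le)
  then obtain r y where ry: "strict_mono r" "y \<in> H" "(\<lambda>k. N (u (r k) - y)) \<longlonglongrightarrow> 0" "shift \<mu> y = 0"
    using convergent_subseq[of u 1 0] u H_intros by auto
  have "y = 0" using inj[OF ry(2)] ry(4) unfolding shift_def by simp
  then have "(\<lambda>k. 1::real) \<longlonglongrightarrow> 0" using ry(3) u by simp
  then show False using LIMSEQ_unique tendsto_const zero_neq_one by metis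
qed

text \<open>The lower bound makes the preimages of an approximating sequence bounded, so that
  \<open>convergent_subseq\<close> produces a preimage of the limit, which lies in \<open>Y\<close>
  by closedness.\<close>

lemma shift_image_nclosed:
  assumes Y: "Y \<subseteq> H" "nclosed Y"
  shows "nclosed (shift \<mu> ` Y)"
  unfolding nclosed_def
proof (intro ballI impI)
  fix x assume x: "x \<in> H" and app: "\<forall>e>0. \<exists>y\<in>shift \<mu> ` Y. N (x - y) < e"
  obtain c where c: "c > 0" "\<And>x. x \<in> H \<Longrightarrow> c * N x \<le> N (shift \<mu> x)" using shift_bounded_below by metis
  have "\<forall>k::nat. \<exists>y\<in>Y. N (x - shift \<mu> y) < inverse (real (Suc k))" using app by simp
  then obtain u where u: "\<And>k::nat. u k \<in> Y" "\<And>k. N (x - shift \<mu> (u k)) < inverse (real (Suc k))" by metis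
  have uH: "u k \<in> H" for k using u Y by blast
  have Au: "N (shift \<mu> (u k) - x) < inverse (real (Suc k))" for k
    using u(2)[of k] N_minus_commute[OF x shift_in[OF uH]] by simp
  have "N (u k) \<le> (1 + N x) / c" for k
  proof -
    have "c * N (u k) \<le> N (shift \<mu> (u k))" using c uH by blast
    also have "\<dots> \<le> N (shift \<mu> (u k) - x) + N x"
      using N_triangle_diff[of "shift \<mu> (u k)" x 0] shift_in uH x H_intros by simp
    also have "\<dots> \<le> 1 + N x" using Au[of k] inverse_le_1_iff[of "real (Suc k)"] by auto
    finally show ?thesis using c by (simp add: field_simps)
  qed
  moreover have "(\<lambda>k. N (shift \<mu> (u k) - x)) \<longlonglongrightarrow> 0"
    using Au by (intro null_seq_mono[OF LIMSEQ_inverse_real_of_nat])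
      (simp_all add: N_nonneg H_intros(2) shift_in uH x less_imp_le)
  ultimately obtain r y where ry: "strict_mono r" "y \<in> H" "(\<lambda>k. N (u (r k) - y)) \<longlonglongrightarrow> 0" "shift \<mu> y = x"
    using convergent_subseq[of u _ x] uH x by metis
  have "\<exists>z\<in>Y. N (y - z) < e" if e: "e > 0" for e
  proof -
    have "\<forall>\<^sub>F k in sequentially. N (u (r k) - y) < e" using ry(3) e by (intro order_tendstoD) auto
    then obtain k where "N (u (r k) - y) < e" by (meson eventually_sequentially order_refl)
    then show ?thesis using u(1) N_minus_commute[OF ry(2) uH[of "r k"]] by (intro bexI[of _ "u (r k)"]) auto
  qed
  then have "y \<in> Y" using Y ry unfolding nclosed_def by blast
  then show "x \<in> shift \<mu> ` Y" using ry by blast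
qed

text \<open>If z is missed, injectivity makes the closed ranges \<open>R k\<close> of the powers
  decrease strictly, with the k-th iterate of z as witness. Riesz's lemma then gives unit vectors x
  k in \<open>R k\<close> at distance at least 1/2 from \<open>R (Suc k)\<close>, and their images
  under \<open>T\<close> stay separated.\<close>

lemma shift_surj: "shift \<mu> ` H = H"
proof (rule ccontr)
  assume "shift \<mu> ` H \<noteq> H"
  then obtain z where z: "z \<in> H" "z \<notin> shift \<mu> ` H" using shift_in by blast
  define R where "R k = (shift \<mu> ^^ k) ` H" for k
  have R_Suc: "R (Suc k) = shift \<mu> ` R k" for k unfolding R_def by (auto simp: image_image)
  have RH: "R k \<subseteq> H" for k by (induction k) (use shift_in in \<open>auto simp: R_Suc, simp add: R_def\<close>)
  have sub: "subspace (R k)" for k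
  proof (induction k)
    case 0 then show ?case using subspace_H by (simp add: R_def)
  next
    case (Suc k)
    have "shift \<mu> 0 = 0" using shift_scale[of 0 0] H_intros by simp
    then have "0 \<in> shift \<mu> ` R k" using subspace_0[OF Suc] by (metis imageI)
    moreover have "x + y \<in> shift \<mu> ` R k" if "x \<in> shift \<mu> ` R k" "y \<in> shift \<mu> ` R k" for x y
      using that shift_add RH subspace_add[OF Suc] by (auto simp: image_iff) (metis subsetD)
    moreover have "c \<odot> x \<in> shift \<mu> ` R k" if "x \<in> shift \<mu> ` R k" for x c
      using that shift_scale RH subspace_scale[OF Suc] by (auto simp: image_iff) (metis subsetD)
    ultimately show ?case unfolding subspace_def R_Suc by blast
  qed
  have closed: "nclosed (R k)" for k
  proof (induction k)
    case 0 then show ?case by (simp add: R_def nclosed_def)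
  next
    case (Suc k) then show ?case using shift_image_nclosed RH R_Suc by simp
  qed
  have dec1: "R (Suc k) \<subseteq> R k" for k
  proof (induction k)
    case 0 then show ?case using shift_in by (auto simp: R_def)
  next
    case (Suc k) then show ?case unfolding R_Suc by blast
  qed
  have dec: "R m \<subseteq> R k" if "k \<le> m" for k m using lift_Suc_antimono_le[of R, OF dec1 that] .
  have inj_shift: "inj_on (shift \<mu>) H"
  proof (rule inj_onI)
    fix x y assume *: "x \<in> H" "y \<in> H" "shift \<mu> x = shift \<mu> y"
    then have "shift \<mu> (x - y) = 0" using shift_diff by simp
    then show "x = y" using inj[of "x - y"] * H_intros unfolding shift_def by simp
  qed
  have strict: "(shift \<mu> ^^ k) z \<in> R k - R (Suc k)" for k
  proof (induction k)
    case 0 then show ?case using z by (auto simp: R_def)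
  next
    case (Suc k)
    have "shift \<mu> ((shift \<mu> ^^ k) z) \<notin> shift \<mu> ` R (Suc k)"
      using Suc RH inj_shift by (auto simp: inj_on_def image_iff) (metis subsetD)
    then show ?case using Suc R_Suc by simp
  qed
  have "\<exists>x. x \<in> R k \<and> N x = 1 \<and> (\<forall>y\<in>R (Suc k). 1/2 \<le> N (x - y))" for k
    using riesz_lemma[OF sub closed sub RH dec1[of k]] strict[of k] by (metis Diff_iff subsetD)
  then obtain x where x: "\<And>k. x k \<in> R k" "\<And>k. N (x k) = 1"
    "\<And>k y. y \<in> R (Suc k) \<Longrightarrow> 1/2 \<le> N (x k - y)" by metis
  have xH: "x k \<in> H" for k using x(1) RH by blast
  show False
  proof (rule no_separated_image[of x 1 "cmod \<mu> / 2"])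
    fix k m :: nat assume km: "k < m"
    \<comment> \<open>Chosen to solve \<open>T (x k) - T (x m) = \<mu> (x k - y)\<close>. All three
      summands lie in \<open>R (Suc k)\<close>: x m and its image because m > k, the image of x k by
      one application of the shift.\<close>
    define y where "y = inverse \<mu> \<odot> (shift \<mu> (x m) + \<mu> \<odot> x m - shift \<mu> (x k))"
    have "x m \<in> R (Suc k)" using x(1)[of m] dec[of "Suc k" m] km by auto
    moreover have "shift \<mu> (x m) \<in> R (Suc k)" using x(1)[of m] R_Suc dec[of "Suc k" "Suc m"] km by auto
    moreover have "shift \<mu> (x k) \<in> R (Suc k)" using x(1)[of k] R_Suc by auto
    ultimately have y: "y \<in> R (Suc k)"
      unfolding y_def by (intro subspace_scale[OF sub] subspace_diff[OF sub] subspace_add[OF sub])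
    have "T (x k) - T (x m) = \<mu> \<odot> (x k - y)"
      unfolding y_def shift_def using \<mu> by (simp add: algebra_simps scale_right_diff_distrib)
    moreover have "x k - y \<in> H" using y RH by (intro H_intros(2) xH) blast
    ultimately have "N (T (x k) - T (x m)) = cmod \<mu> * N (x k - y)" using N_scale by metis
    then show "cmod \<mu> / 2 \<le> N (T (x k) - T (x m))"
      using x(3)[OF y] mult_left_mono[of "1/2" "N (x k - y)" "cmod \<mu>"] by simp
  qed (use x xH \<mu> in auto)
qed

end

end

section \<open>The spaces as normed spaces\<close>

abbreviation (input) disk :: "complex set" where "disk \<equiv> ball 0 1"

lemma rcis_in_disk: "0 \<le> r \<Longrightarrow> r < 1 \<Longrightarrow> complex_of_real r * cis t \<in> disk"
  by (simp add: norm_mult)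

lemma one_minus_norm_sq_pos: "z \<in> disk \<Longrightarrow> 0 < 1 - (cmod z)\<^sup>2"
  by (simp add: power_less_one_iff abs_square_less_1)

section \<open>Circular means, the Bergman density and pointwise domination\<close>

lemma continuous_on_circle:
  assumes f: "continuous_on disk f" and r: "0 < r" "r < 1"
  shows "continuous_on S (\<lambda>t. (cmod (f (of_real r * cis t)))\<^sup>2)"
proof -
  have "continuous_on S (\<lambda>t. f (of_real r * cis t))"
    by (rule continuous_on_compose2[OF f]) (use r rcis_in_disk in \<open>auto intro!: continuous_intros\<close>)
  then show ?thesis by (intro continuous_intros)
qed

lemma circ_mean2_nonneg: "0 \<le> circ_mean2 f r"
  \<comment> \<open>The integral of a non-integrable function is 0, so the bound covers arbitrary
    f.\<close>
  unfolding circ_mean2_def by (cases "(\<lambda>t. (cmod (f (of_real r * cis t)))\<^sup>2) integrable_on {0..2*pi}")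
    (auto intro!: divide_nonneg_pos integral_nonneg simp: not_integrable_integral)

lemma circ_mean2_le:
  assumes c: "continuous_on disk f" "continuous_on disk g" "continuous_on disk h"
    and r: "0 < r" "r < 1"
    and le: "\<And>z. z \<in> disk \<Longrightarrow> (cmod (h z))\<^sup>2 \<le> a * (cmod (f z))\<^sup>2 + b * (cmod (g z))\<^sup>2"
  shows "circ_mean2 h r \<le> a * circ_mean2 f r + b * circ_mean2 g r"
proof -
  have int: "(\<lambda>t. (cmod (u (of_real r * cis t)))\<^sup>2) integrable_on {0..2*pi}"
    if "continuous_on disk u" for u
    using that r by (intro integrable_continuous_interval continuous_on_circle)
  have "integral {0..2*pi} (\<lambda>t. (cmod (h (of_real r * cis t)))\<^sup>2)
      \<le> integral {0..2*pi} (\<lambda>t. a * (cmod (f (of_real r * cis t)))\<^sup>2 + b * (cmod (g (of_real r * cis t)))\<^sup>2)"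
    using le rcis_in_disk r
    by (intro integral_le int c integrable_add integrable_on_mult_right) auto
  also have "\<dots> = a * integral {0..2*pi} (\<lambda>t. (cmod (f (of_real r * cis t)))\<^sup>2)
      + b * integral {0..2*pi} (\<lambda>t. (cmod (g (of_real r * cis t)))\<^sup>2)"
    using c by (subst integral_add) (auto intro!: integrable_on_mult_right int)
  finally show ?thesis unfolding circ_mean2_def by (simp add: field_simps)
qed

lemma continuous_on_weight: "continuous_on disk (\<lambda>z. (1 - (cmod z)\<^sup>2) powr \<alpha>)"
  using one_minus_norm_sq_pos by (intro continuous_intros) (metis less_irrefl)

lemma continuous_on_berg_dens:
  assumes "continuous_on disk f"
  shows "continuous_on disk (berg_dens \<alpha> f)"
proof -
  have "continuous_on disk (\<lambda>z. (cmod (f z))\<^sup>2 * (\<alpha> + 1) * (1 - (cmod z)\<^sup>2) powr \<alpha> * (1 / pi))"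
    using assms by (intro continuous_on_weight continuous_on_mult continuous_on_const continuous_on_power continuous_on_norm)
  then show ?thesis unfolding berg_dens_def by simp
qed

lemma berg_dens_nonneg: "\<alpha> \<ge> -1 \<Longrightarrow> 0 \<le> berg_dens \<alpha> f z"
  unfolding berg_dens_def by simp

lemma Hspace_holomorphic: "f \<in> Hspace \<alpha> \<Longrightarrow> f holomorphic_on disk"
  by (simp add: Hspace_def)

lemma Hspace_continuous: "f \<in> Hspace \<alpha> \<Longrightarrow> continuous_on disk f"
  by (simp add: Hspace_def holomorphic_on_imp_continuous_on)

lemma Hnorm_sq:
  assumes "\<alpha> \<ge> -1" "f \<in> Hspace \<alpha>"
  shows "(Hnorm \<alpha> f)\<^sup>2 = (if \<alpha> = -1 then (SUP r\<in>{0<..<1}. circ_mean2 f r)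
                      else integral disk (berg_dens \<alpha> f))" (is "_ = ?R")
    and "0 \<le> Hnorm \<alpha> f"
proof -
  have "0 \<le> ?R"
  proof (cases "\<alpha> = -1")
    case True
    \<comment> \<open>The radius 1/2 is an arbitrary sample bounding the supremum from
      below.\<close>
    have "0 \<le> circ_mean2 f (1/2)" by (rule circ_mean2_nonneg)
    also have "\<dots> \<le> (SUP r\<in>{0<..<1}. circ_mean2 f r)"
      using assms True by (intro cSUP_upper) (auto simp: Hspace_def)
    finally show ?thesis using True by simp
  next
    case False
    then show ?thesis using assms berg_dens_nonneg by (auto simp: Hspace_def intro!: integral_nonneg)
  qed
  then show "(Hnorm \<alpha> f)\<^sup>2 = ?R" "0 \<le> Hnorm \<alpha> f" unfolding Hnorm_def by simp_all
qed

text \<open>Common source of the membership and norm estimates in both cases. Quadratic domination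
  fits because the squared norm is an integral of |f|^2 or a supremum of such integrals; two
  dominating functions are what sums require.\<close>

lemma Hspace_dominated:
  assumes \<alpha>: "\<alpha> \<ge> -1" and f: "f \<in> Hspace \<alpha>" and g: "g \<in> Hspace \<alpha>" and h: "h holomorphic_on disk"
    and ab: "0 \<le> a" "0 \<le> b"
    and le: "\<And>z. z \<in> disk \<Longrightarrow> (cmod (h z))\<^sup>2 \<le> a * (cmod (f z))\<^sup>2 + b * (cmod (g z))\<^sup>2"
  shows "h \<in> Hspace \<alpha>" "(Hnorm \<alpha> h)\<^sup>2 \<le> a * (Hnorm \<alpha> f)\<^sup>2 + b * (Hnorm \<alpha> g)\<^sup>2"
proof -
  note c = Hspace_continuous[OF f] Hspace_continuous[OF g] holomorphic_on_imp_continuous_on[OF h]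
  have "h \<in> Hspace \<alpha> \<and> (Hnorm \<alpha> h)\<^sup>2 \<le> a * (Hnorm \<alpha> f)\<^sup>2 + b * (Hnorm \<alpha> g)\<^sup>2"
  proof (cases "\<alpha> = -1")
    case True
    have bf: "circ_mean2 u r \<le> (Hnorm \<alpha> u)\<^sup>2" if "u \<in> Hspace \<alpha>" "r \<in> {0<..<1}" for u r
      unfolding Hnorm_sq(1)[OF \<alpha> that(1)] using True that by (auto simp: Hspace_def intro: cSUP_upper)
    have bh: "circ_mean2 h r \<le> a * (Hnorm \<alpha> f)\<^sup>2 + b * (Hnorm \<alpha> g)\<^sup>2" if r: "r \<in> {0<..<1}" for r
    proof -
      have "circ_mean2 h r \<le> a * circ_mean2 f r + b * circ_mean2 g r"
        using r by (intro circ_mean2_le c le) auto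
      also have "\<dots> \<le> a * (Hnorm \<alpha> f)\<^sup>2 + b * (Hnorm \<alpha> g)\<^sup>2"
        using bf f g r ab by (intro add_mono mult_left_mono) auto
      finally show ?thesis .
    qed
    have hin: "h \<in> Hspace \<alpha>" using True h bh unfolding Hspace_def
      by (auto intro!: bdd_aboveI2[where M = "a * (Hnorm \<alpha> f)\<^sup>2 + b * (Hnorm \<alpha> g)\<^sup>2"])
    moreover have "(SUP r\<in>{0<..<1}. circ_mean2 h r) \<le> a * (Hnorm \<alpha> f)\<^sup>2 + b * (Hnorm \<alpha> g)\<^sup>2"
      using bh by (intro cSUP_least) auto
    ultimately show ?thesis using Hnorm_sq(1)[OF \<alpha> hin] True by simp
  next
    case False
    have int: "berg_dens \<alpha> f integrable_on disk" "berg_dens \<alpha> g integrable_on disk"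
      using f g False by (auto simp: Hspace_def)
    have bnd: "berg_dens \<alpha> h z \<le> a * berg_dens \<alpha> f z + b * berg_dens \<alpha> g z" if "z \<in> disk" for z
    proof -
      have "(cmod (h z))\<^sup>2 * ((\<alpha> + 1) * (1 - (cmod z)\<^sup>2) powr \<alpha> / pi)
        \<le> (a * (cmod (f z))\<^sup>2 + b * (cmod (g z))\<^sup>2) * ((\<alpha> + 1) * (1 - (cmod z)\<^sup>2) powr \<alpha> / pi)"
        using \<alpha> by (intro mult_right_mono le that) auto
      then show ?thesis unfolding berg_dens_def by (simp add: algebra_simps add_divide_distrib)
    qed
    have intR: "(\<lambda>z. a * berg_dens \<alpha> f z + b * berg_dens \<alpha> g z) integrable_on disk"
      by (intro integrable_add integrable_on_mult_right int)
    have inth: "berg_dens \<alpha> h integrable_on disk"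
      using bnd intR \<alpha> berg_dens_nonneg
      by (intro measurable_bounded_by_integrable_imp_integrable_real[OF _ intR])
        (auto intro!: continuous_imp_measurable_on_sets_lebesgue continuous_on_berg_dens c)
    then have hin: "h \<in> Hspace \<alpha>" using h False by (simp add: Hspace_def)
    have "integral disk (berg_dens \<alpha> h) \<le> integral disk (\<lambda>z. a * berg_dens \<alpha> f z + b * berg_dens \<alpha> g z)"
      by (intro integral_le inth intR bnd)
    also have "\<dots> = a * integral disk (berg_dens \<alpha> f) + b * integral disk (berg_dens \<alpha> g)"
      using int by (subst integral_add) (auto intro: integrable_on_mult_right)
    finally show ?thesis using Hnorm_sq(1)[OF \<alpha>] hin f g False by simp
  qed
  then show "h \<in> Hspace \<alpha>" "(Hnorm \<alpha> h)\<^sup>2 \<le> a * (Hnorm \<alpha> f)\<^sup>2 + b * (Hnorm \<alpha> g)\<^sup>2" by auto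
qed

lemma Hnorm_mono:
  assumes \<alpha>: "\<alpha> \<ge> -1" and f: "f \<in> Hspace \<alpha>" and h: "h holomorphic_on disk" and "0 \<le> a"
    and le: "\<And>z. z \<in> disk \<Longrightarrow> cmod (h z) \<le> a * cmod (f z)"
  shows "h \<in> Hspace \<alpha>" "Hnorm \<alpha> h \<le> a * Hnorm \<alpha> f"
proof -
  have "(cmod (h z))\<^sup>2 \<le> a\<^sup>2 * (cmod (f z))\<^sup>2 + 0 * (cmod (f z))\<^sup>2" if "z \<in> disk" for z
    using power_mono[OF le[OF that], of 2] by (simp add: power_mult_distrib)
  note * = Hspace_dominated[OF \<alpha> f f h _ _ this]
  show hin: "h \<in> Hspace \<alpha>" using * by simp
  have "(Hnorm \<alpha> h)\<^sup>2 \<le> (a * Hnorm \<alpha> f)\<^sup>2" using * by (simp add: power_mult_distrib)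
  then show "Hnorm \<alpha> h \<le> a * Hnorm \<alpha> f"
    by (rule power2_le_imp_le) (intro mult_nonneg_nonneg Hnorm_sq(2)[OF \<alpha> f] \<open>0 \<le> a\<close>)
qed

lemma Hspace_cong:
  assumes \<alpha>: "\<alpha> \<ge> -1" and f: "f \<in> Hspace \<alpha>" and eq: "\<And>z. z \<in> disk \<Longrightarrow> h z = f z"
  shows "h \<in> Hspace \<alpha>" "Hnorm \<alpha> h = Hnorm \<alpha> f"
proof -
  have h: "h holomorphic_on disk"
    using Hspace_holomorphic[OF f] eq holomorphic_transform by metis
  show hin: "h \<in> Hspace \<alpha>" using Hnorm_mono(1)[OF \<alpha> f h, of 1] eq by simp
  show "Hnorm \<alpha> h = Hnorm \<alpha> f"
    using Hnorm_mono(2)[OF \<alpha> f h, of 1] Hnorm_mono(2)[OF \<alpha> hin Hspace_holomorphic[OF f], of 1] eq by simp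
qed

text \<open>Young's inequality for the cross term, from the square of t|x| - |y| divided by t. It
  brings a sum into the form that \<open>Hspace_dominated\<close> accepts, with t free for later
  optimisation.\<close>

lemma norm_add_sq_le:
  fixes x y :: "'a::real_normed_vector" and t :: real
  assumes "t > 0"
  shows "(norm (x + y))\<^sup>2 \<le> (1 + t) * (norm x)\<^sup>2 + (1 + 1/t) * (norm y)\<^sup>2"
proof -
  have "(norm (x + y))\<^sup>2 \<le> (norm x + norm y)\<^sup>2" by (intro power_mono norm_triangle_ineq) auto
  moreover have "0 \<le> (t * norm x - norm y)\<^sup>2 / t" using assms by simp
  moreover have "(t * norm x - norm y)\<^sup>2 / t = t * (norm x)\<^sup>2 - 2 * norm x * norm y + (norm y)\<^sup>2 / t"
    using assms by (simp add: power2_eq_square field_simps)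
  ultimately show ?thesis by (simp add: power2_sum algebra_simps)
qed

text \<open>Optimising over \<open>t\<close> recovers the triangle inequality from quadratic domination.\<close>
lemma sq_le_imp_triangle:
  fixes a b c :: real
  assumes nn: "0 \<le> a" "0 \<le> b" "0 \<le> c"
    and *: "\<And>t. t > 0 \<Longrightarrow> c\<^sup>2 \<le> (1 + t) * a\<^sup>2 + (1 + 1/t) * b\<^sup>2"
  shows "c \<le> a + b"
proof (rule field_le_epsilon)
  fix e :: real assume e: "e > 0"
  \<comment> \<open>The optimal t is b/a, which fails when a or b is 0. Enlarging both by e/2 makes
    t = y/x legitimate, and at this t the bound is exactly (x + y)^2.\<close>
  define x y where "x = a + e/2" and "y = b + e/2"
  have xy: "x > 0" "y > 0" "a \<le> x" "b \<le> y" using nn e unfolding x_def y_def by auto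
  have "c\<^sup>2 \<le> (1 + y/x) * a\<^sup>2 + (1 + 1/(y/x)) * b\<^sup>2" using xy by (intro *) auto
  also have "\<dots> \<le> (1 + y/x) * x\<^sup>2 + (1 + 1/(y/x)) * y\<^sup>2"
    using xy nn by (intro add_mono mult_left_mono power_mono) auto
  also have "\<dots> = (x + y)\<^sup>2" using xy by (simp add: field_simps power2_eq_square)
  finally have "c \<le> x + y" by (rule power2_le_imp_le) (use xy in simp)
  then show "c \<le> a + b + e" unfolding x_def y_def by simp
qed

lemma Hspace_add:
  assumes \<alpha>: "\<alpha> \<ge> -1" and f: "f \<in> Hspace \<alpha>" and g: "g \<in> Hspace \<alpha>"
  shows "(\<lambda>z. f z + g z) \<in> Hspace \<alpha>" "Hnorm \<alpha> (\<lambda>z. f z + g z) \<le> Hnorm \<alpha> f + Hnorm \<alpha> g"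
proof -
  have h: "(\<lambda>z. f z + g z) holomorphic_on disk"
    using f g Hspace_holomorphic by (intro holomorphic_intros)
  note * = Hspace_dominated[OF \<alpha> f g h _ _ norm_add_sq_le]
  show hin: "(\<lambda>z. f z + g z) \<in> Hspace \<alpha>" by (rule *[of 1]) auto
  show "Hnorm \<alpha> (\<lambda>z. f z + g z) \<le> Hnorm \<alpha> f + Hnorm \<alpha> g"
    by (rule sq_le_imp_triangle[OF Hnorm_sq(2)[OF \<alpha> f] Hnorm_sq(2)[OF \<alpha> g] Hnorm_sq(2)[OF \<alpha> hin]])
      (rule *(2), simp_all)
qed

lemma Hspace_cmult:
  assumes \<alpha>: "\<alpha> \<ge> -1" and f: "f \<in> Hspace \<alpha>"
  shows "(\<lambda>z. c * f z) \<in> Hspace \<alpha>" "Hnorm \<alpha> (\<lambda>z. c * f z) = cmod c * Hnorm \<alpha> f"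
proof -
  have le: "(\<lambda>z. c * u z) \<in> Hspace \<alpha> \<and> Hnorm \<alpha> (\<lambda>z. c * u z) \<le> cmod c * Hnorm \<alpha> u"
    if u: "u \<in> Hspace \<alpha>" for c u
  proof -
    have "(\<lambda>z. c * u z) holomorphic_on disk"
      by (intro holomorphic_intros Hspace_holomorphic[OF u])
    from Hnorm_mono[OF \<alpha> u this, of "cmod c"] show ?thesis by (simp add: norm_mult)
  qed
  show cin: "(\<lambda>z. c * f z) \<in> Hspace \<alpha>" using le f by blast
  show "Hnorm \<alpha> (\<lambda>z. c * f z) = cmod c * Hnorm \<alpha> f"
  proof (cases "c = 0")
    case True
    then show ?thesis using le[OF f, of c] Hnorm_sq(2)[OF \<alpha> cin] by simp
  next
    case False
    \<comment> \<open>The reverse inequality: scale back by the inverse of c.\<close>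
    have "Hnorm \<alpha> f \<le> cmod (inverse c) * Hnorm \<alpha> (\<lambda>z. c * f z)"
      using le[OF cin, of "inverse c"] False by (simp add: mult.assoc[symmetric])
    then have "cmod c * Hnorm \<alpha> f \<le> cmod c * (cmod (inverse c) * Hnorm \<alpha> (\<lambda>z. c * f z))"
      by (intro mult_left_mono) auto
    also have "\<dots> = Hnorm \<alpha> (\<lambda>z. c * f z)" using False by (simp add: norm_inverse)
    finally show ?thesis using le[OF f, of c] by simp
  qed
qed

text \<open>A continuous nonnegative function with integral 0 vanishes. This is applied on each
  circle in the Hardy case, and on a closed box around z, where the density has a positive weight,
  in the Bergman case.\<close>

lemma Hnorm_eq_0_imp:
  assumes \<alpha>: "\<alpha> \<ge> -1" and f: "f \<in> Hspace \<alpha>" and 0: "Hnorm \<alpha> f = 0" and z: "z \<in> disk"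
  shows "f z = 0"
proof (cases "\<alpha> = -1")
  case True
  have off0: "f z = 0" if z: "z \<in> disk" "z \<noteq> 0" for z
  proof -
    define r where "r = cmod z"
    have r: "0 < r" "r < 1" using z unfolding r_def by auto
    let ?g = "\<lambda>t. (cmod (f (of_real r * cis t)))\<^sup>2"
    have cont: "continuous_on (cbox 0 (2*pi)) ?g"
      by (rule continuous_on_circle[OF Hspace_continuous[OF f] r])
    have "circ_mean2 f r \<le> (SUP r\<in>{0<..<1}. circ_mean2 f r)"
      using f True r by (intro cSUP_upper) (auto simp: Hspace_def)
    also have "\<dots> = 0" using Hnorm_sq(1)[OF \<alpha> f] 0 True by simp
    finally have "circ_mean2 f r = 0" using circ_mean2_nonneg[of f r] by simp
    then have "integral {0..2*pi} ?g = 0" unfolding circ_mean2_def by simp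
    then have hi: "(?g has_integral 0) (cbox 0 (2*pi))"
      using integrable_integral[OF integrable_continuous[OF cont]] by simp
    have "?g t = 0" if "t \<in> cbox 0 (2*pi)" for t
      using has_integral_0_cbox_imp_0[OF cont _ hi _ that] pi_gt_zero by (auto simp: box_eq_empty)
    moreover have "Arg2pi z \<in> cbox 0 (2*pi)" using Arg2pi_lt_2pi[of z] Arg2pi_ge_0[of z] by simp
    ultimately have "f (of_real r * cis (Arg2pi z)) = 0" by fastforce
    then show ?thesis unfolding r_def using Arg2pi_eq[of z] by (simp add: cis_conv_exp mult.commute)
  qed
  show ?thesis
  proof (cases "z = 0")
    case True
    \<comment> \<open>The centre lies on no circle of positive radius, so it is reached by
      continuity.\<close>
    have "(f \<longlongrightarrow> f 0) (at 0)"
      using Hspace_continuous[OF f] by (simp add: continuous_on_eq_continuous_at isCont_def)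
    moreover have "\<forall>\<^sub>F z in at 0. f z = 0"
      using off0 eventually_at_ball[of 1 0 UNIV] by (auto simp: eventually_at dist_norm intro!: exI[of _ 1])
    then have "(f \<longlongrightarrow> 0) (at 0)" by (rule tendsto_eventually)
    ultimately show ?thesis using True tendsto_unique[OF at_neq_bot] by blast
  qed (use off0 z in auto)
next
  case False
  obtain a b where ab: "z \<in> box a b" "cbox a b \<subseteq> disk"
    by (rule open_contains_cbox[OF open_ball z])
  have int: "berg_dens \<alpha> f integrable_on disk" using f False by (simp add: Hspace_def)
  have cont: "continuous_on (cbox a b) (berg_dens \<alpha> f)"
    using continuous_on_subset[OF continuous_on_berg_dens[OF Hspace_continuous[OF f]] ab(2)] .
  have "integral (cbox a b) (berg_dens \<alpha> f) \<le> integral disk (berg_dens \<alpha> f)"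
    using berg_dens_nonneg[OF \<alpha>] by (intro integral_subset_le ab int integrable_continuous cont) auto
  also have "\<dots> = 0" using Hnorm_sq(1)[OF \<alpha> f] 0 False by simp
  finally have "integral (cbox a b) (berg_dens \<alpha> f) = 0"
    using integral_nonneg[OF integrable_continuous[OF cont]] berg_dens_nonneg[OF \<alpha>] by (meson antisym)
  then have hi: "(berg_dens \<alpha> f has_integral 0) (cbox a b)"
    using integrable_integral[OF integrable_continuous[OF cont]] by simp
  have "berg_dens \<alpha> f z = 0"
    using has_integral_0_cbox_imp_0[OF cont _ hi] ab(1) berg_dens_nonneg[OF \<alpha>] box_subset_cbox by blast
  then show ?thesis using False one_minus_norm_sq_pos[OF z] by (simp add: berg_dens_def)
qed

text \<open>For \<open>\<alpha> < 0\<close> cut the disk into the annuli \<open>1 - 2\<^sup>-\<^sup>k \<le> |z| < 1 - 2\<^sup>-\<^sup>k\<^sup>-\<^sup>1\<close>, of area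
\<open>O(2\<^sup>-\<^sup>k)\<close>; the resulting geometric series converges as \<open>\<alpha> > -1\<close>.\<close>
lemma integrable_weight:
  assumes \<alpha>: "\<alpha> > -1"
  shows "(\<lambda>z::complex. (1 - (cmod z)\<^sup>2) powr \<alpha>) integrable_on disk"
proof (cases "\<alpha> \<ge> 0")
  case True
  have i1: "(\<lambda>z::complex. 1::real) integrable_on disk" by (intro integrable_on_const lmeasurable_ball)
  have "\<bar>(1 - (cmod z)\<^sup>2) powr \<alpha>\<bar> \<le> 1" if "z \<in> disk" for z
    using one_minus_norm_sq_pos[OF that] True powr_mono2[of \<alpha> "1 - (cmod z)\<^sup>2" 1] by simp
  then show ?thesis
    using continuous_on_weight by (intro measurable_bounded_by_integrable_imp_integrable_real[OF _ i1])
      (auto intro!: continuous_imp_measurable_on_sets_lebesgue)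
next
  case False
  \<comment> \<open>\<open>A k\<close> is the whole outer ring \<open>1 - 2^-k <= |z| < 1\<close>,
    hence contains the k-th annulus. The overlaps only enlarge the majorant, and the ring still has
    area at most 2V/2^k.\<close>
  define A where "A k = ball 0 1 - ball (0::complex) (1 - 1/2^k)" for k :: nat
  \<comment> \<open>On the k-th annulus \<open>1 - |z|^2 >= 1 - |z| > 2^-(k+1)\<close>, and a
    negative power is decreasing, so \<open>c k\<close> bounds the weight there.\<close>
  define c where "c k = (1/2^(Suc k)) powr \<alpha>" for k :: nat
  define V where "V = measure lborel (ball (0::complex) 1)"
  have mA: "A k \<in> sets lborel" for k unfolding A_def by simp
  have VA: "emeasure lborel (A k) \<le> ennreal (2 * V / 2^k)" for k
  proof -
    have k: "(0::real) \<le> 1 - 1/2^k" "1 - 1/2^k \<le> (1::real)" by (auto simp: field_simps)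
    have "emeasure lborel (A k) = ennreal (measure lborel (A k))"
      using emeasure_mono[of "A k" "ball 0 1" lborel] emeasure_lborel_ball_finite[of "0::complex" 1]
      by (intro emeasure_eq_ennreal_measure) (auto simp: A_def top_unique)
    also have "measure lborel (A k) = V - measure lborel (ball (0::complex) (1 - 1/2^k))"
      unfolding A_def V_def
      by (intro measure_Diff) (use k emeasure_lborel_ball_finite[of "0::complex" 1] in \<open>auto simp: subset_ball less_top\<close>)
    also have "measure lborel (ball (0::complex) (1 - 1/2^k)) = (1 - 1/2^k)\<^sup>2 * V"
      unfolding V_def using k content_ball[of "1 - 1/2^k" "0::complex"] content_ball[of 1 "0::complex"] by simp
    also have "V - (1 - 1/2^k)\<^sup>2 * V \<le> 2 * V / 2^k"
    proof -
      have "0 \<le> (1/2^k)\<^sup>2 * V" unfolding V_def by simp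
      then show ?thesis by (simp add: power2_diff algebra_simps)
    qed
    finally show ?thesis by (simp add: ennreal_leI)
  qed
  have pt: "ennreal ((1 - (cmod z)\<^sup>2) powr \<alpha>) * indicator disk z \<le> (\<Sum>k. ennreal (c k) * indicator (A k) z)" for z
  proof (cases "z \<in> disk")
    case True
    define s where "s = 1 - cmod z"
    have s: "0 < s" "s \<le> 1" using True by (auto simp: s_def)
    have ex: "\<exists>k. 1/2^(Suc k) < s"
    proof -
      obtain n where "(1/2)^n < s" using real_arch_pow_inv[of s "1/2"] s by auto
      moreover have "(1/2::real)^(Suc n) \<le> (1/2)^n" by simp
      ultimately show ?thesis by (intro exI[of _ n]) (simp add: power_one_over)
    qed
    \<comment> \<open>Leastness gives \<open>2^-(k+1) < s <= 2^-k\<close>, the index of the annulus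
      containing z; for k = 0 the upper bound is s <= 1.\<close>
    define k where "k = (LEAST k. 1/2^(Suc k) < s)"
    have k1: "1/2^(Suc k) < s" unfolding k_def using ex by (rule LeastI_ex)
    have k2: "s \<le> 1/2^k"
    proof (cases k)
      case 0 then show ?thesis using s by simp
    next
      case (Suc j)
      then have "\<not> 1/2^(Suc j) < s" using not_less_Least[of j "\<lambda>k. 1/2^(Suc k) < s"] unfolding k_def by simp
      then show ?thesis using Suc by simp
    qed
    have zA: "z \<in> A k" using True k2 by (auto simp: A_def s_def)
    have "cmod z * cmod z \<le> cmod z * 1" using True by (intro mult_left_mono) auto
    then have "s \<le> 1 - (cmod z)\<^sup>2" by (simp add: s_def power2_eq_square)
    then have "(1 - (cmod z)\<^sup>2) powr \<alpha> \<le> c k"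
      unfolding c_def using k1 s False by (intro powr_mono2') auto
    then have "ennreal ((1 - (cmod z)\<^sup>2) powr \<alpha>) * indicator disk z \<le> ennreal (c k) * indicator (A k) z"
      using True zA by (simp add: ennreal_leI)
    also have "\<dots> \<le> (\<Sum>k. ennreal (c k) * indicator (A k) z)"
      using sum_le_suminf[of "\<lambda>k. ennreal (c k) * indicator (A k) z" "{k}"]
      by (simp del: mult_indicator_subset sum_mult_indicator)
    finally show ?thesis .
  qed simp
  \<comment> \<open>This exposes the geometric ratio \<open>(1/2) powr (1 + \<alpha>)\<close>, which
    is below 1 because \<open>\<alpha> > -1\<close>.\<close>
  have ck: "c k * (2 * V / 2^k) = 2 * V * (1/2) powr \<alpha> * ((1/2) powr (1 + \<alpha>))^k" for k
  proof -
    have "c k = ((1/2) powr real (Suc k)) powr \<alpha>"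
      unfolding c_def by (subst powr_realpow) (simp_all add: power_one_over)
    also have "\<dots> = (1/2) powr \<alpha> * (1/2) powr (\<alpha> * real k)"
      by (simp add: powr_powr powr_add[symmetric] algebra_simps)
    finally have ck: "c k = (1/2) powr \<alpha> * (1/2) powr (\<alpha> * real k)" .
    have "((1/2::real) powr (1 + \<alpha>))^k = (1/2) powr ((1 + \<alpha>) * real k)"
      by (simp add: powr_powr[symmetric] powr_realpow)
    also have "\<dots> = (1/2) powr (\<alpha> * real k) * (1/2) powr real k"
      by (simp add: powr_add[symmetric] algebra_simps)
    also have "(1/2::real) powr real k = 1/2^k" by (simp add: powr_realpow power_one_over)
    finally show ?thesis using ck by simp
  qed
  have "summable (\<lambda>k. ((1/2::real) powr (1 + \<alpha>))^k)"
    using \<alpha> by (intro summable_geometric) (use powr_less_mono2[of "1 + \<alpha>" "1/2" 1] in simp)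
  then have sm: "summable (\<lambda>k. c k * (2 * V / 2^k))" unfolding ck by (intro summable_mult)
  have Vnn: "0 \<le> V" unfolding V_def by simp
  have "(\<integral>\<^sup>+z. ennreal ((1 - (cmod z)\<^sup>2) powr \<alpha>) * indicator disk z \<partial>lborel)
      \<le> (\<integral>\<^sup>+z. (\<Sum>k. ennreal (c k) * indicator (A k) z) \<partial>lborel)"
    by (intro nn_integral_mono pt)
  also have "\<dots> = (\<Sum>k. \<integral>\<^sup>+z. ennreal (c k) * indicator (A k) z \<partial>lborel)"
    using mA by (intro nn_integral_suminf) auto
  also have "\<dots> = (\<Sum>k. ennreal (c k) * emeasure lborel (A k))"
    using mA by (simp add: nn_integral_cmult_indicator)
  also have "\<dots> \<le> (\<Sum>k. ennreal (c k * (2 * V / 2^k)))"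
  proof (intro suminf_le)
    fix k
    have "ennreal (c k) * emeasure lborel (A k) \<le> ennreal (c k) * ennreal (2 * V / 2^k)"
      by (intro mult_left_mono VA) simp
    also have "\<dots> = ennreal (c k * (2 * V / 2^k))" by (intro ennreal_mult'[symmetric]) (simp add: c_def)
    finally show "ennreal (c k) * emeasure lborel (A k) \<le> ennreal (c k * (2 * V / 2^k))" .
  qed auto
  also have "\<dots> = ennreal (\<Sum>k. c k * (2 * V / 2^k))"
    using sm Vnn by (intro suminf_ennreal2) (auto simp: c_def)
  also have "\<dots> < \<infinity>" by simp
  finally have fin: "(\<integral>\<^sup>+z. ennreal ((1 - (cmod z)\<^sup>2) powr \<alpha> * indicator disk z) \<partial>lborel) < \<infinity>"
    by (simp add: ennreal_mult'' ennreal_indicator)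
  have "integrable lborel (\<lambda>z. (1 - (cmod z)\<^sup>2) powr \<alpha> * indicator disk z)"
    using fin borel_measurable_continuous_on_indicator[OF _ continuous_on_weight[of \<alpha>]]
    by (intro integrableI_nonneg) (auto simp: mult.commute)
  then have "set_integrable lborel disk (\<lambda>z. (1 - (cmod z)\<^sup>2) powr \<alpha>)"
    unfolding set_integrable_def by (simp add: mult.commute)
  then show ?thesis by (rule set_borel_integral_eq_integral(1))
qed

section \<open>Bounded holomorphic functions lie in the spaces\<close>

lemma one_in_Hspace:
  assumes "\<alpha> \<ge> -1"
  shows "(\<lambda>_. 1) \<in> Hspace \<alpha>"
proof (cases "\<alpha> = -1")
  case True
  then show ?thesis by (auto simp: Hspace_def circ_mean2_def intro!: bdd_aboveI2)
next
  case False
  then have "(\<lambda>z::complex. (\<alpha> + 1) / pi * ((1 - (cmod z)\<^sup>2) powr \<alpha>)) integrable_on disk"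
    using assms by (intro integrable_on_mult_right integrable_weight) auto
  then have "berg_dens \<alpha> (\<lambda>_. 1) integrable_on disk"
    unfolding berg_dens_def by (simp add: algebra_simps)
  then show ?thesis using False by (simp add: Hspace_def)
qed

lemma bounded_holomorphic_in_Hspace:
  assumes "\<alpha> \<ge> -1" "f holomorphic_on disk" "\<And>z. z \<in> disk \<Longrightarrow> cmod (f z) \<le> M"
  shows "f \<in> Hspace \<alpha>"
proof -
  have "0 \<le> M" using assms(3)[of 0] norm_ge_zero[of "f 0"] by (simp del: norm_ge_zero)
  then show ?thesis
    using assms by (intro Hnorm_mono(1)[OF assms(1) one_in_Hspace[OF assms(1)], of f M]) auto
qed

section \<open>Leading terms of holomorphic functions\<close>

text \<open>Order at least l at w, with l-th Taylor coefficient c; c = 0 is allowed. The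
  factorisation over all of \<open>S\<close> makes products and compositions immediate.\<close>

definition has_leading :: "complex set \<Rightarrow> complex \<Rightarrow> nat \<Rightarrow> complex \<Rightarrow> (complex \<Rightarrow> complex) \<Rightarrow> bool" where
  "has_leading S w l c f \<longleftrightarrow>
     (\<exists>G. G holomorphic_on S \<and> (\<forall>z\<in>S. f z = (z - w) ^ l * G z) \<and> G w = c)"

lemma has_leadingI:
  assumes "G holomorphic_on S" "\<And>z. z \<in> S \<Longrightarrow> f z = (z - w) ^ l * G z" "G w = c"
  shows "has_leading S w l c f"
  using assms unfolding has_leading_def by blast

lemma has_leadingE:
  assumes "has_leading S w l c f"
  obtains G where "G holomorphic_on S" "\<And>z. z \<in> S \<Longrightarrow> f z = (z - w) ^ l * G z" "G w = c"
  using assms unfolding has_leading_def by blast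

lemma has_leading_cong:
  "has_leading S w l c f \<Longrightarrow> (\<And>z. z \<in> S \<Longrightarrow> g z = f z) \<Longrightarrow> has_leading S w l c g"
  unfolding has_leading_def by simp

lemma has_leading_0:
  "f holomorphic_on S \<Longrightarrow> has_leading S w 0 (f w) f"
  by (rule has_leadingI[of f]) auto

lemma has_leading_power: "has_leading S w l 1 (\<lambda>z. (z - w) ^ l)"
  by (rule has_leadingI[of "\<lambda>_. 1"]) auto

lemma has_leading_weaken:
  assumes "has_leading S w m c f" "l < m"
  shows "has_leading S w l 0 f"
proof -
  obtain G where G: "G holomorphic_on S" "\<And>z. z \<in> S \<Longrightarrow> f z = (z - w) ^ m * G z"
    using assms(1) by (rule has_leadingE) blast
  have "f z = (z - w) ^ l * ((z - w) ^ (m - l) * G z)" if "z \<in> S" for z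
    using G(2)[OF that] assms(2) by (simp add: power_add[symmetric] mult.assoc[symmetric])
  then show ?thesis
    using G(1) assms(2) by (intro has_leadingI[of "\<lambda>z. (z - w) ^ (m - l) * G z"]) (auto intro!: holomorphic_intros)
qed

lemma has_leading_mult:
  assumes "has_leading S w l a f" "has_leading S w m b g"
  shows "has_leading S w (l + m) (a * b) (\<lambda>z. f z * g z)"
proof -
  obtain F where F: "F holomorphic_on S" "\<And>z. z \<in> S \<Longrightarrow> f z = (z - w) ^ l * F z" "F w = a"
    using assms(1) by (rule has_leadingE) blast
  obtain G where G: "G holomorphic_on S" "\<And>z. z \<in> S \<Longrightarrow> g z = (z - w) ^ m * G z" "G w = b"
    using assms(2) by (rule has_leadingE) blast
  show ?thesis
    using F G by (intro has_leadingI[of "\<lambda>z. F z * G z"]) (auto intro!: holomorphic_intros simp: power_add)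
qed

lemma has_leading_add:
  assumes "has_leading S w l a f" "has_leading S w l b g"
  shows "has_leading S w l (a + b) (\<lambda>z. f z + g z)"
proof -
  obtain F where F: "F holomorphic_on S" "\<And>z. z \<in> S \<Longrightarrow> f z = (z - w) ^ l * F z" "F w = a"
    using assms(1) by (rule has_leadingE) blast
  obtain G where G: "G holomorphic_on S" "\<And>z. z \<in> S \<Longrightarrow> g z = (z - w) ^ l * G z" "G w = b"
    using assms(2) by (rule has_leadingE) blast
  show ?thesis
    using F G by (intro has_leadingI[of "\<lambda>z. F z + G z"]) (auto intro!: holomorphic_intros simp: distrib_left)
qed

lemma has_leading_cmult:
  assumes "has_leading S w l a f"
  shows "has_leading S w l (c * a) (\<lambda>z. c * f z)"
  using has_leading_mult[OF has_leading_0[OF holomorphic_on_const[of c]] assms] by simp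

lemma has_leading_deriv:
  assumes S: "open S" and f: "has_leading S w (Suc l) c f"
  shows "has_leading S w l (of_nat (Suc l) * c) (deriv f)"
proof -
  obtain G where G: "G holomorphic_on S" "\<And>z. z \<in> S \<Longrightarrow> f z = (z - w) ^ Suc l * G z" "G w = c"
    using f by (rule has_leadingE) blast
  \<comment> \<open>Product rule; at w the new cofactor takes the value (l+1) c.\<close>
  have "deriv f z = (z - w) ^ l * (of_nat (Suc l) * G z + (z - w) * deriv G z)" if z: "z \<in> S" for z
  proof -
    have G': "(G has_field_derivative deriv G z) (at z)" using G(1) S z holomorphic_derivI by blast
    have "((\<lambda>z. (z - w) ^ Suc l * G z) has_field_derivative
        (z - w) ^ l * (of_nat (Suc l) * G z + (z - w) * deriv G z)) (at z)"
      by (rule derivative_eq_intros G' refl)+ (simp add: algebra_simps)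
    then have "(f has_field_derivative (z - w) ^ l * (of_nat (Suc l) * G z + (z - w) * deriv G z)) (at z)"
      by (rule has_field_derivative_transform_within_open[OF _ S z]) (simp add: G(2))
    then show ?thesis by (rule DERIV_imp_deriv)
  qed
  then show ?thesis
    using G S by (intro has_leadingI[of "\<lambda>z. of_nat (Suc l) * G z + (z - w) * deriv G z"])
      (auto intro!: holomorphic_intros)
qed

lemma has_leading_higher_deriv:
  assumes S: "open S" and f: "has_leading S w l c f" and "n \<le> l"
  shows "has_leading S w (l - n) (fact l / fact (l - n) * c) ((deriv ^^ n) f)"
  using \<open>n \<le> l\<close>
proof (induction n)
  case 0
  then show ?case using f by simp
next
  case (Suc n)
  then have l: "l - n = Suc (l - Suc n)" by simp
  from Suc have "has_leading S w (Suc (l - Suc n)) (fact l / fact (l - n) * c) ((deriv ^^ n) f)"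
    using l by simp
  from has_leading_deriv[OF S this]
  have "has_leading S w (l - Suc n) (of_nat (l - n) * (fact l / fact (l - n) * c)) ((deriv ^^ Suc n) f)"
    using l by simp
  moreover have "of_nat (l - n) * (fact l / fact (l - n) * c) = fact l / fact (l - Suc n) * c"
    unfolding l by (simp add: fact_Suc del: of_nat_Suc)
  ultimately show ?case by simp
qed

text \<open>Differentiating l times leaves order 0, so the coefficient is read off at w; after fewer
  derivatives a factor z - w survives.\<close>

lemma has_leading_imp_deriv:
  assumes S: "open S" "w \<in> S" and f: "has_leading S w l c f"
  shows "(deriv ^^ l) f w = fact l * c" "j < l \<Longrightarrow> (deriv ^^ j) f w = 0"
proof -
  show "(deriv ^^ l) f w = fact l * c"
    using has_leading_higher_deriv[OF S(1) f, of l] S(2) by (auto elim!: has_leadingE)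
  show "(deriv ^^ j) f w = 0" if "j < l"
    using has_leading_higher_deriv[OF S(1) f, of j] S(2) that by (auto elim!: has_leadingE)
qed

lemma has_leading_unique:
  assumes "open S" "w \<in> S" "has_leading S w l a f" "has_leading S w l b f"
  shows "a = b"
  using has_leading_imp_deriv(1)[OF assms(1,2,3)] has_leading_imp_deriv(1)[OF assms(1,2,4)] by simp

text \<open>The cofactor is the difference quotient, its removable singularity filled with the
  derivative.\<close>

lemma holomorphic_factor_zero:
  assumes S: "open S" "w \<in> S" and f: "f holomorphic_on S" "f w = 0"
  shows "has_leading S w 1 (deriv f w) f"
  using pole_lemma[OF f(1), of w] S f(2)
  by (intro has_leadingI[of "\<lambda>z. if z = w then deriv f w else (f z - f w) / (z - w)"])
    (auto simp: interior_open)

lemma has_leading_Suc: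
  assumes S: "open S" "w \<in> S" and f: "has_leading S w l 0 f"
  obtains c where "has_leading S w (Suc l) c f"
proof -
  obtain G where G: "G holomorphic_on S" "\<And>z. z \<in> S \<Longrightarrow> f z = (z - w) ^ l * G z" "G w = 0"
    using f by (rule has_leadingE) blast
  have "has_leading S w (l + 1) (1 * deriv G w) (\<lambda>z. (z - w) ^ l * G z)"
    by (intro has_leading_mult has_leading_power holomorphic_factor_zero S G)
  then have "has_leading S w (l + 1) (1 * deriv G w) f" by (rule has_leading_cong) (rule G(2))
  then show ?thesis using that by simp
qed

text \<open>Translates the hypothesis on \<open>\<psi>n\<close> into a factorisation. Each vanishing
  derivative yields one more factor z - w, and \<open>has_leading_imp_deriv\<close> identifies the
  new coefficient.\<close>

lemma higher_deriv_imp_has_leading: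
  assumes S: "open S" "w \<in> S" and f: "f holomorphic_on S" and 0: "\<And>j. j < l \<Longrightarrow> (deriv ^^ j) f w = 0"
  shows "has_leading S w l ((deriv ^^ l) f w / fact l) f"
  using 0
proof (induction l)
  case 0
  then show ?case using has_leading_0[OF f] by simp
next
  case (Suc l)
  then have "has_leading S w l 0 f" using Suc.IH Suc.prems[of l] by simp
  then obtain c where c: "has_leading S w (Suc l) c f" using has_leading_Suc[OF S] by metis
  have "(deriv ^^ Suc l) f w / fact (Suc l) = c"
    unfolding has_leading_imp_deriv(1)[OF S c] by (rule nonzero_mult_div_cancel_left) (rule fact_nonzero)
  then show ?case using c by simp
qed

text \<open>At the fixed point, \<open>\<phi> z - w = (z - w) P z\<close> with
  \<open>P w = deriv \<phi> w\<close>; the l-th power of P supplies the factor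
  \<open>deriv \<phi> w ^ l\<close>.\<close>

lemma has_leading_compose:
  assumes S: "open S" "w \<in> S" and f: "has_leading S w l a f"
    and \<phi>: "\<phi> holomorphic_on S" "\<phi> ` S \<subseteq> S" "\<phi> w = w"
  shows "has_leading S w l (a * deriv \<phi> w ^ l) (\<lambda>z. f (\<phi> z))"
proof -
  obtain F where F: "F holomorphic_on S" "\<And>z. z \<in> S \<Longrightarrow> f z = (z - w) ^ l * F z" "F w = a"
    using f by (rule has_leadingE) blast
  have d: "deriv (\<lambda>z. \<phi> z - w) w = deriv \<phi> w"
    using \<phi>(1) S holomorphic_on_imp_differentiable_at by simp
  have "has_leading S w 1 (deriv \<phi> w) (\<lambda>z. \<phi> z - w)"
    using holomorphic_factor_zero[OF S holomorphic_on_diff[OF \<phi>(1) holomorphic_on_const[of w]]] \<phi>(3)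
    unfolding d by simp
  then obtain P where P: "P holomorphic_on S" "\<And>z. z \<in> S \<Longrightarrow> \<phi> z - w = (z - w) ^ 1 * P z" "P w = deriv \<phi> w"
    by (rule has_leadingE) blast
  have "(\<lambda>z. F (\<phi> z)) holomorphic_on S"
    using holomorphic_on_compose_gen[OF \<phi>(1) F(1)] \<phi>(2) by (auto simp: o_def)
  then have "(\<lambda>z. P z ^ l * F (\<phi> z)) holomorphic_on S" using P(1) by (intro holomorphic_intros)
  moreover have "f (\<phi> z) = (z - w) ^ l * (P z ^ l * F (\<phi> z))" if "z \<in> S" for z
    using F(2)[of "\<phi> z"] P(2)[OF that] \<phi>(2) that by (auto simp: power_mult_distrib)
  moreover have "P w ^ l * F (\<phi> w) = a * deriv \<phi> w ^ l"
    unfolding P(3) \<phi>(3) F(3) by (rule mult.commute)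
  ultimately show ?thesis by (rule has_leadingI)
qed

text \<open>By the identity theorem on a connected set, a function that is not identically zero has
  a nonvanishing derivative at w; l is the least order of one.\<close>

lemma has_leading_exists:
  assumes S: "open S" "connected S" "w \<in> S" and f: "f holomorphic_on S" and z: "z \<in> S" "f z \<noteq> 0"
  obtains l c where "has_leading S w l c f" "c \<noteq> 0"
proof -
  have "\<exists>l. (deriv ^^ l) f w \<noteq> 0"
  proof (rule ccontr)
    assume "\<not> ?thesis"
    then have "f z = 0" using holomorphic_fun_eq_0_on_connected[OF f S(1,2) _ S(3) z(1)] by blast
    then show False using z by simp
  qed
  then have l: "(deriv ^^ (LEAST l. (deriv ^^ l) f w \<noteq> 0)) f w \<noteq> 0" (is "(deriv ^^ ?l) f w \<noteq> 0")
    by (rule LeastI_ex)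
  have "(deriv ^^ j) f w = 0" if "j < ?l" for j using not_less_Least[OF that] by simp
  then have "has_leading S w ?l ((deriv ^^ ?l) f w / fact ?l) f"
    by (rule higher_deriv_imp_has_leading[OF S(1,3) f])
  then show ?thesis using that l by simp
qed

text \<open>The l-th diagonal entry, where a, b, c, d stand for \<open>\<psi>0 w\<close>,
  \<open>deriv \<phi>0 w\<close>, the n-th derivative of \<open>\<psi>n\<close> at w, and
  \<open>deriv \<phi>n w\<close>.\<close>

definition eigenval :: "complex \<Rightarrow> complex \<Rightarrow> complex \<Rightarrow> complex \<Rightarrow> nat \<Rightarrow> nat \<Rightarrow> complex" where
  "eigenval a b c d n l = a * b ^ l + (if l < n then 0 else of_nat (l choose n) * c * d ^ (l - n))"

lemma has_leading_Cop_Dop: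
  assumes S: "open S" "w \<in> S" and f: "has_leading S w l c f"
    and \<psi>: "\<psi>0 holomorphic_on S" "\<psi>n holomorphic_on S" "\<And>j. j < n \<Longrightarrow> (deriv ^^ j) \<psi>n w = 0"
    and \<phi>0: "\<phi>0 holomorphic_on S" "\<phi>0 ` S \<subseteq> S" "\<phi>0 w = w"
    and \<phi>n: "\<phi>n holomorphic_on S" "\<phi>n ` S \<subseteq> S" "\<phi>n w = w"
  shows "has_leading S w l
      (eigenval (\<psi>0 w) (deriv \<phi>0 w) ((deriv ^^ n) \<psi>n w) (deriv \<phi>n w) n l * c)
      (\<lambda>z. Cop \<psi>0 \<phi>0 f z + Dop \<psi>n \<phi>n n f z)"
proof -
  have f_hol: "f holomorphic_on S"
  proof -
    obtain F where F: "F holomorphic_on S" "\<And>z. z \<in> S \<Longrightarrow> f z = (z - w) ^ l * F z"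
      using f by (rule has_leadingE) blast
    have "(\<lambda>z. (z - w) ^ l * F z) holomorphic_on S" by (intro holomorphic_intros F)
    then show ?thesis by (rule holomorphic_transform) (simp add: F(2))
  qed
  have C: "has_leading S w l (\<psi>0 w * deriv \<phi>0 w ^ l * c) (Cop \<psi>0 \<phi>0 f)"
    using has_leading_mult[OF has_leading_0[OF \<psi>(1)] has_leading_compose[OF S f \<phi>0]]
    by (simp add: Cop_def mult_ac)
  have n: "has_leading S w n ((deriv ^^ n) \<psi>n w / fact n) \<psi>n"
    by (rule higher_deriv_imp_has_leading[OF S \<psi>(2,3)])
  have D: "has_leading S w l
      ((if l < n then 0 else of_nat (l choose n) * (deriv ^^ n) \<psi>n w * deriv \<phi>n w ^ (l - n)) * c)
      (Dop \<psi>n \<phi>n n f)"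
  proof (cases "l < n")
    case True
    \<comment> \<open>Nothing is known about the n-th derivative of f at w, but the factor
      \<open>\<psi>n\<close> alone gives order n > l, hence coefficient 0 at order l.\<close>
    have "has_leading S w 0 ((deriv ^^ n) f w) ((deriv ^^ n) f)"
      using f_hol S by (intro has_leading_0 holomorphic_higher_deriv)
    from has_leading_mult[OF n has_leading_compose[OF S this \<phi>n]]
    show ?thesis using True has_leading_weaken by (auto simp: Dop_def)
  next
    case False
    have "has_leading S w (l - n) (fact l / fact (l - n) * c) ((deriv ^^ n) f)"
      using has_leading_higher_deriv[OF S(1) f] False by simp
    from has_leading_mult[OF n has_leading_compose[OF S this \<phi>n]]
    show ?thesis using False by (simp add: Dop_def binomial_fact mult_ac)
  qed
  show ?thesis
    using has_leading_add[OF C D] by (simp add: eigenval_def distrib_right)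
qed

section \<open>The spectrum\<close>

text \<open>\<^const>\<open>Hspace\<close> identifies functions that agree on the disk. Setting them to 0 off the disk
selects one representative of each class, so that the norm is definite and operators are linear on the nose.\<close>
definition cut :: "(complex \<Rightarrow> complex) \<Rightarrow> complex \<Rightarrow> complex" where
  "cut f = (\<lambda>z. if z \<in> disk then f z else 0)"

definition fscale :: "complex \<Rightarrow> (complex \<Rightarrow> complex) \<Rightarrow> complex \<Rightarrow> complex" where
  "fscale c f = (\<lambda>z. c * f z)"

definition Hcut :: "real \<Rightarrow> (complex \<Rightarrow> complex) set" where
  "Hcut \<alpha> = {f \<in> Hspace \<alpha>. \<forall>z. z \<notin> disk \<longrightarrow> f z = 0}"

lemma cut_in_Hcut:
  assumes "\<alpha> \<ge> -1" "f \<in> Hspace \<alpha>"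
  shows "cut f \<in> Hcut \<alpha>" "Hnorm \<alpha> (cut f) = Hnorm \<alpha> f"
  using Hspace_cong[OF assms, of "cut f"] by (auto simp: Hcut_def cut_def)

lemma Hcut_eqI: "f \<in> Hcut \<alpha> \<Longrightarrow> g \<in> Hcut \<alpha> \<Longrightarrow> (\<And>z. z \<in> disk \<Longrightarrow> f z = g z) \<Longrightarrow> f = g"
  unfolding Hcut_def fun_eq_iff mem_Collect_eq by metis

lemma Hcut_in_Hspace: "f \<in> Hcut \<alpha> \<Longrightarrow> f \<in> Hspace \<alpha>"
  by (simp add: Hcut_def)

lemma zero_in_Hspace: "\<alpha> \<ge> -1 \<Longrightarrow> (\<lambda>_. 0) \<in> Hspace \<alpha>"
  by (rule bounded_holomorphic_in_Hspace[of _ _ 0]) auto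

lemma vector_space_fscale: "vector_space fscale"
  by unfold_locales (auto simp: fscale_def fun_eq_iff algebra_simps)

lemma normed_carrier_Hcut:
  assumes \<alpha>: "\<alpha> \<ge> -1"
  shows "normed_carrier fscale (Hcut \<alpha>) (Hnorm \<alpha>)"
proof -
  interpret vector_space fscale by (rule vector_space_fscale)
  show ?thesis
  proof unfold_locales
    show "subspace (Hcut \<alpha>)"
      unfolding subspace_def Hcut_def fscale_def plus_fun_def zero_fun_def
      using zero_in_Hspace[OF \<alpha>] Hspace_add(1)[OF \<alpha>] Hspace_cmult(1)[OF \<alpha>] by auto
    show "Hnorm \<alpha> (x + y) \<le> Hnorm \<alpha> x + Hnorm \<alpha> y" if "x \<in> Hcut \<alpha>" "y \<in> Hcut \<alpha>" for x y
      using Hspace_add(2)[OF \<alpha>] that unfolding Hcut_def plus_fun_def by blast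
    show "Hnorm \<alpha> (fscale c x) = cmod c * Hnorm \<alpha> x" if "x \<in> Hcut \<alpha>" for c x
      using Hspace_cmult(2)[OF \<alpha>] that unfolding Hcut_def fscale_def by blast
    show "x = 0" if "x \<in> Hcut \<alpha>" "Hnorm \<alpha> x = 0" for x
      using Hnorm_eq_0_imp[OF \<alpha>] that unfolding Hcut_def fun_eq_iff zero_fun_def by blast
  qed
qed

text \<open>The constant in \<open>bounded_op\<close> may be negative. Passing to its absolute value
  relies on nonnegative norms, hence the guard \<open>\<alpha> \<ge> -1\<close>.\<close>

lemma bounded_opD:
  assumes "bounded_op \<alpha> T"
  shows "f \<in> Hspace \<alpha> \<Longrightarrow> T f \<in> Hspace \<alpha>"
    and "\<lbrakk>f \<in> Hspace \<alpha>; g \<in> Hspace \<alpha>; z \<in> disk\<rbrakk> \<Longrightarrow> T (\<lambda>x. f x + c * g x) z = T f z + c * T g z"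
    and "\<exists>C\<ge>0. \<forall>f\<in>Hspace \<alpha>. \<alpha> \<ge> -1 \<longrightarrow> Hnorm \<alpha> (T f) \<le> C * Hnorm \<alpha> f"
proof -
  show "f \<in> Hspace \<alpha> \<Longrightarrow> T f \<in> Hspace \<alpha>"
    and "\<lbrakk>f \<in> Hspace \<alpha>; g \<in> Hspace \<alpha>; z \<in> disk\<rbrakk> \<Longrightarrow> T (\<lambda>x. f x + c * g x) z = T f z + c * T g z"
    using assms unfolding bounded_op_def by blast+
  obtain C where C: "\<And>f. f \<in> Hspace \<alpha> \<Longrightarrow> Hnorm \<alpha> (T f) \<le> C * Hnorm \<alpha> f"
    using assms unfolding bounded_op_def by blast
  have "Hnorm \<alpha> (T f) \<le> \<bar>C\<bar> * Hnorm \<alpha> f" if "f \<in> Hspace \<alpha>" "\<alpha> \<ge> -1" for f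
    using C[OF that(1)] mult_right_mono[OF abs_ge_self Hnorm_sq(2)[OF that(2,1)], of C] by simp
  then show "\<exists>C\<ge>0. \<forall>f\<in>Hspace \<alpha>. \<alpha> \<ge> -1 \<longrightarrow> Hnorm \<alpha> (T f) \<le> C * Hnorm \<alpha> f"
    by (intro exI[of _ "\<bar>C\<bar>"]) auto
qed

text \<open>An abstract operator could look at values off the disk. But f - g has norm 0, so by
  boundedness its image has norm 0 and vanishes on the disk.\<close>

lemma bounded_op_cong:
  assumes \<alpha>: "\<alpha> \<ge> -1" and T: "bounded_op \<alpha> T" and f: "f \<in> Hspace \<alpha>" and g: "g \<in> Hspace \<alpha>"
    and eq: "\<And>z. z \<in> disk \<Longrightarrow> f z = g z" and z: "z \<in> disk"
  shows "T f z = T g z"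
proof -
  define h where "h = (\<lambda>x. f x + (-1) * g x)"
  have "Hnorm \<alpha> (\<lambda>_. 0) = 0" using Hspace_cmult(2)[OF \<alpha> f, of 0] by simp
  then have h: "h \<in> Hspace \<alpha>" "Hnorm \<alpha> h = 0"
    using Hspace_cong[OF \<alpha> zero_in_Hspace[OF \<alpha>], of h] eq unfolding h_def by auto
  obtain C where "\<forall>f\<in>Hspace \<alpha>. \<alpha> \<ge> -1 \<longrightarrow> Hnorm \<alpha> (T f) \<le> C * Hnorm \<alpha> f"
    using bounded_opD(3)[OF T] by blast
  then have "Hnorm \<alpha> (T h) \<le> C * Hnorm \<alpha> h" using h(1) \<alpha> by blast
  then have "Hnorm \<alpha> (T h) = 0" using h Hnorm_sq(2)[OF \<alpha> bounded_opD(1)[OF T h(1)]] by simp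
  then have "T h z = 0" using Hnorm_eq_0_imp[OF \<alpha> bounded_opD(1)[OF T h(1)]] z by blast
  then show ?thesis using bounded_opD(2)[OF T f g z, of "-1"] unfolding h_def by simp
qed

lemma compact_endo_cut:
  assumes \<alpha>: "\<alpha> \<ge> -1" and T: "compact_op \<alpha> T"
  shows "compact_endo fscale (Hcut \<alpha>) (Hnorm \<alpha>) (\<lambda>f. cut (T f))"
proof -
  interpret normed_carrier fscale "Hcut \<alpha>" "Hnorm \<alpha>" by (rule normed_carrier_Hcut[OF \<alpha>])
  have b: "bounded_op \<alpha> T" using T unfolding compact_op_def by blast
  note D = bounded_opD(1,2)[OF b]
  have T0: "T (\<lambda>_. 0) z = 0" if "z \<in> disk" for z
    using D(2)[OF zero_in_Hspace[OF \<alpha>] zero_in_Hspace[OF \<alpha>] that, of 1] by simp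
  show ?thesis
  proof unfold_locales
    fix x y c
    assume x: "x \<in> Hcut \<alpha>"
    then have xH: "x \<in> Hspace \<alpha>" by (rule Hcut_in_Hspace)
    show "cut (T x) \<in> Hcut \<alpha>" using cut_in_Hcut[OF \<alpha> D(1)[OF xH]] by blast
    show "cut (T (fscale c x)) = fscale c (cut (T x))"
      using D(2)[OF zero_in_Hspace[OF \<alpha>] xH, of _ c] T0
      by (auto simp: cut_def fscale_def fun_eq_iff)
    assume "y \<in> Hcut \<alpha>"
    then have yH: "y \<in> Hspace \<alpha>" by (rule Hcut_in_Hspace)
    show "cut (T (x + y)) = cut (T x) + cut (T y)"
      using D(2)[OF xH yH, of _ 1] by (auto simp: cut_def fun_eq_iff plus_fun_def)
  next
    obtain C where "\<forall>f\<in>Hspace \<alpha>. \<alpha> \<ge> -1 \<longrightarrow> Hnorm \<alpha> (T f) \<le> C * Hnorm \<alpha> f"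
      using bounded_opD(3)[OF b] by blast
    then show "\<exists>C. \<forall>x\<in>Hcut \<alpha>. Hnorm \<alpha> (cut (T x)) \<le> C * Hnorm \<alpha> x"
      using cut_in_Hcut(2)[OF \<alpha> D(1)] \<alpha> Hcut_in_Hspace by metis
  next
    fix u :: "nat \<Rightarrow> complex \<Rightarrow> complex" and B
    assume u: "\<And>k. u k \<in> Hcut \<alpha>" "\<And>k. Hnorm \<alpha> (u k) \<le> B"
    have uH: "u k \<in> Hspace \<alpha>" for k using u(1) by (rule Hcut_in_Hspace)
    obtain r g where r: "strict_mono r" "g \<in> Hspace \<alpha>"
      "(\<lambda>k. Hnorm \<alpha> (\<lambda>z. T (u (r k)) z - g z)) \<longlonglongrightarrow> 0"
      using T uH u(2) unfolding compact_op_def by blast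
    have "Hnorm \<alpha> (cut (T (u (r k))) - cut g) = Hnorm \<alpha> (\<lambda>z. T (u (r k)) z - g z)" for k
    proof -
      have "(\<lambda>z. T (u (r k)) z - g z) \<in> Hspace \<alpha>"
        using Hspace_add(1)[OF \<alpha> D(1)[OF uH] Hspace_cmult(1)[OF \<alpha> r(2), of "-1"], of "r k"] by simp
      from cut_in_Hcut(2)[OF \<alpha> this]
      have "Hnorm \<alpha> (cut (\<lambda>z. T (u (r k)) z - g z)) = Hnorm \<alpha> (\<lambda>z. T (u (r k)) z - g z)" .
      moreover have "cut (\<lambda>z. T (u (r k)) z - g z) = cut (T (u (r k))) - cut g"
        by (auto simp: cut_def fun_eq_iff)
      ultimately show ?thesis by simp
    qed
    then show "\<exists>r g. strict_mono r \<and> g \<in> Hcut \<alpha> \<and> (\<lambda>k. Hnorm \<alpha> (cut (T (u (r k))) - g)) \<longlonglongrightarrow> 0"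
      using r cut_in_Hcut(1)[OF \<alpha> r(2)] by (intro exI[of _ r] exI[of _ "cut g"]) simp
  qed
qed

lemma Hspace_power:
  assumes "\<alpha> \<ge> -1"
  shows "(\<lambda>z. (z - w) ^ l) \<in> Hspace \<alpha>"
proof (rule bounded_holomorphic_in_Hspace[OF assms])
  show "(\<lambda>z. (z - w) ^ l) holomorphic_on disk" by (intro holomorphic_intros)
  fix z assume "z \<in> disk"
  then have "cmod (z - w) \<le> 1 + cmod w" using norm_triangle_ineq4[of z w] by simp
  then show "cmod ((z - w) ^ l) \<le> (1 + cmod w) ^ l" by (simp add: norm_power power_mono)
qed

text \<open>A bounded left inverse would bound \<open>T\<close> from below, against
  \<open>infinite_dim_not_bounded_below\<close> for the monomials.\<close>

lemma zero_in_spec: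
  assumes \<alpha>: "\<alpha> \<ge> -1" and T: "compact_op \<alpha> T"
  shows "0 \<in> spec \<alpha> T"
proof (rule ccontr)
  assume "0 \<notin> spec \<alpha> T"
  then obtain S where S: "bounded_op \<alpha> S"
    "\<And>f z. f \<in> Hspace \<alpha> \<Longrightarrow> z \<in> disk \<Longrightarrow> S (\<lambda>x. T f x - 0 * f x) z = f z"
    unfolding spec_def by auto
  interpret E: compact_endo fscale "Hcut \<alpha>" "Hnorm \<alpha>" "\<lambda>f. cut (T f)"
    by (rule compact_endo_cut[OF \<alpha> T])
  have b: "bounded_op \<alpha> T" using T unfolding compact_op_def by blast
  obtain C where C: "C \<ge> 0" "\<forall>f\<in>Hspace \<alpha>. \<alpha> \<ge> -1 \<longrightarrow> Hnorm \<alpha> (S f) \<le> C * Hnorm \<alpha> f"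
    using bounded_opD(3)[OF S(1)] by blast
  define e where "e k = cut (\<lambda>z. z ^ k)" for k
  have eH: "e k \<in> Hcut \<alpha>" for k
    unfolding e_def using cut_in_Hcut(1)[OF \<alpha> Hspace_power[OF \<alpha>, of 0 k]] by simp
  have indep: "e k \<notin> E.span (e ` {..<k})" for k
  proof
    assume ek: "e k \<in> E.span (e ` {..<k})"
    \<comment> \<open>Functions agreeing on the disk with a polynomial of degree below k: a subspace
      containing the first k monomials. It misses the next one, since a nonzero polynomial has
      finitely many roots.\<close>
    define P where "P = {f. \<exists>p. (\<forall>i\<ge>k. coeff p i = 0) \<and> (\<forall>z\<in>disk. f z = poly p z)}"
    have "E.subspace P"
      unfolding E.subspace_def
    proof (intro conjI ballI allI)
      show "0 \<in> P" unfolding P_def by (auto intro!: exI[of _ 0])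
      fix x assume "x \<in> P"
      then obtain p where p: "\<forall>i\<ge>k. coeff p i = 0" "\<forall>z\<in>disk. x z = poly p z" unfolding P_def by blast
      show "fscale c x \<in> P" for c
        unfolding P_def fscale_def using p by (auto intro!: exI[of _ "smult c p"])
      fix y assume "y \<in> P"
      then obtain q where q: "\<forall>i\<ge>k. coeff q i = 0" "\<forall>z\<in>disk. y z = poly q z" unfolding P_def by blast
      show "x + y \<in> P"
        unfolding P_def using p q by (auto intro!: exI[of _ "p + q"])
    qed
    moreover have "e ` {..<k} \<subseteq> P"
    proof
      fix f assume "f \<in> e ` {..<k}"
      then obtain j where "j < k" "f = e j" by blast
      then show "f \<in> P" unfolding P_def e_def cut_def
        by (auto intro!: exI[of _ "monom 1 j"] simp: poly_monom)
    qed
    ultimately have "e k \<in> P" using ek E.span_minimal by blast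
    then obtain p where p: "\<forall>i\<ge>k. coeff p i = 0" "\<forall>z\<in>disk. e k z = poly p z" unfolding P_def by blast
    have "disk \<subseteq> {z. poly (monom 1 k - p) z = 0}"
      using p(2) by (auto simp: e_def cut_def poly_monom)
    then have "infinite {z. poly (monom 1 k - p) z = 0}"
      using uncountable_ball[of 1 "0::complex"] countable_finite finite_subset by auto
    then have "monom 1 k - p = 0" using poly_roots_finite by blast
    then have "coeff (monom 1 k - p) k = 0" by simp
    then show False using p(1) by simp
  qed
  \<comment> \<open>With C + 1 the constant is positive even for C = 0, and the estimates end in (C
    + 1) N(x) <= C N(x), hence N(x) <= 0, although N(x) is positive.\<close>
  obtain x where x: "x \<in> Hcut \<alpha>" "Hnorm \<alpha> (cut (T x)) < 1 / (C + 1) * Hnorm \<alpha> x"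
    using E.infinite_dim_not_bounded_below[of e "1 / (C + 1)", OF eH indep] C(1) by auto
  have xH: "x \<in> Hspace \<alpha>" by (rule Hcut_in_Hspace[OF x(1)])
  have Tx: "Hnorm \<alpha> (cut (T x)) = Hnorm \<alpha> (T x)" using cut_in_Hcut(2)[OF \<alpha> bounded_opD(1)[OF b xH]] .
  have TxH: "(\<lambda>z. T x z - 0 * x z) \<in> Hspace \<alpha>" using bounded_opD(1)[OF b xH] by simp
  have "Hnorm \<alpha> x = Hnorm \<alpha> (S (\<lambda>z. T x z - 0 * x z))"
    using S(2)[OF xH] by (intro Hspace_cong(2)[OF \<alpha> bounded_opD(1)[OF S(1) TxH]]) simp
  also have "\<dots> \<le> C * Hnorm \<alpha> (T x)" using C(2) TxH \<alpha> by auto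
  also have "\<dots> \<le> C * (1 / (C + 1) * Hnorm \<alpha> x)" using x(2) C(1) unfolding Tx by (intro mult_left_mono) auto
  finally have le: "(C + 1) * Hnorm \<alpha> x \<le> C * Hnorm \<alpha> x" using C(1) by (simp add: field_simps)
  then have "Hnorm \<alpha> x \<le> 0" by (simp add: distrib_right)
  then show False using x(2) E.N_nonneg[OF E.T_in[OF x(1)]] C(1)
    by (smt (verit) mult_nonneg_nonpos zero_le_divide_1_iff)
qed

text \<open>Surjectivity of the shift provides the inverse and the lower bound makes it bounded.
  What remains is to pass from representatives in \<open>Hcut\<close> to an operator on all of
  \<open>Hspace\<close>.\<close>

lemma not_in_spec:
  assumes \<alpha>: "\<alpha> \<ge> -1" and T: "compact_op \<alpha> T" and \<mu>: "\<mu> \<noteq> 0"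
    and inj: "\<And>f z. f \<in> Hspace \<alpha> \<Longrightarrow> (\<And>z. z \<in> disk \<Longrightarrow> T f z = \<mu> * f z) \<Longrightarrow> z \<in> disk \<Longrightarrow> f z = 0"
  shows "\<mu> \<notin> spec \<alpha> T"
proof -
  interpret E: compact_endo fscale "Hcut \<alpha>" "Hnorm \<alpha>" "\<lambda>f. cut (T f)"
    by (rule compact_endo_cut[OF \<alpha> T])
  have b: "bounded_op \<alpha> T" using T unfolding compact_op_def by blast
  note D = bounded_opD(1,2)[OF b]
  have inj0: "x = 0" if "x \<in> Hcut \<alpha>" "cut (T x) = fscale \<mu> x" for x
  proof -
    have "T x z = \<mu> * x z" if "z \<in> disk" for z
      using fun_cong[OF \<open>cut (T x) = fscale \<mu> x\<close>, of z] that by (simp add: cut_def fscale_def)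
    then have "x z = 0" if "z \<in> disk" for z using inj Hcut_in_Hspace \<open>x \<in> Hcut \<alpha>\<close> that by blast
    then show ?thesis using \<open>x \<in> Hcut \<alpha>\<close> by (auto simp: Hcut_def fun_eq_iff) 
  qed
  have surj: "E.shift \<mu> ` Hcut \<alpha> = Hcut \<alpha>" using E.shift_surj[OF \<mu> inj0] .
  obtain c where c: "c > 0" "\<And>x. x \<in> Hcut \<alpha> \<Longrightarrow> c * Hnorm \<alpha> x \<le> Hnorm \<alpha> (E.shift \<mu> x)"
    using E.shift_bounded_below[OF \<mu> inj0] by metis
  have shift: "E.shift \<mu> f z = T f z - \<mu> * f z" if "z \<in> disk" for f z
    using that unfolding E.shift_def by (simp add: cut_def fscale_def)
  define R where "R g f \<longleftrightarrow> f \<in> Hcut \<alpha> \<and> (\<forall>z\<in>disk. T f z - \<mu> * f z = g z)" for g f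
  have R_unique: "f1 = f2" if "R g f1" "R g f2" for g f1 f2
  proof -
    have f12: "f1 \<in> Hcut \<alpha>" "f2 \<in> Hcut \<alpha>" using that by (auto simp: R_def)
    note H12 = f12[THEN Hcut_in_Hspace]
    have H: "(\<lambda>x. f1 x + (-1) * f2 x) \<in> Hspace \<alpha>"
      using Hspace_add(1)[OF \<alpha> H12(1) Hspace_cmult(1)[OF \<alpha> H12(2)]] .
    have "f1 z + (-1) * f2 z = 0" if "z \<in> disk" for z
    proof (rule inj[OF H _ that])
      fix z assume z: "z \<in> disk"
      have "T f1 z - \<mu> * f1 z = T f2 z - \<mu> * f2 z" using \<open>R g f1\<close> \<open>R g f2\<close> z by (simp add: R_def)
      then show "T (\<lambda>x. f1 x + (-1) * f2 x) z = \<mu> * (f1 z + (-1) * f2 z)"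
        unfolding D(2)[OF H12 z] by (simp add: algebra_simps)
    qed
    then show ?thesis by (intro Hcut_eqI[OF f12]) simp
  qed
  \<comment> \<open>On \<open>Hspace\<close> the choice is forced by \<open>R_unique\<close>;
    linearity and the left inverse law then follow by exhibiting a solution of the equation.\<close>
  define S where "S g = (SOME f. R g f)" for g
  have RS: "R g (S g)" if g: "g \<in> Hspace \<alpha>" for g
  proof -
    obtain f where f: "f \<in> Hcut \<alpha>" "E.shift \<mu> f = cut g"
      using cut_in_Hcut(1)[OF \<alpha> g] surj by (metis imageE)
    have "R g f" unfolding R_def using f(1) shift[symmetric] f(2) by (simp add: cut_def)
    then show ?thesis unfolding S_def by (rule someI[of "R g"])
  qed
  have S_H: "S g \<in> Hcut \<alpha>" "z \<in> disk \<Longrightarrow> T (S g) z - \<mu> * S g z = g z" if "g \<in> Hspace \<alpha>" for g z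
    using RS[OF that] by (auto simp: R_def)
  have S_eqI: "S g = f" if "g \<in> Hspace \<alpha>" "R g f" for g f using R_unique RS that by blast
  have "bounded_op \<alpha> S"
    unfolding bounded_op_def
  proof (intro conjI ballI allI)
    fix f assume f: "f \<in> Hspace \<alpha>"
    show "S f \<in> Hspace \<alpha>" using S_H(1)[OF f] by (rule Hcut_in_Hspace)
    fix g c z assume g: "g \<in> Hspace \<alpha>" and z: "z \<in> disk"
    have H: "(\<lambda>x. f x + c * g x) \<in> Hspace \<alpha>"
      using Hspace_add(1)[OF \<alpha> f Hspace_cmult(1)[OF \<alpha> g]] .
    note HS = S_H(1)[OF f, THEN Hcut_in_Hspace] S_H(1)[OF g, THEN Hcut_in_Hspace]
    have "(\<lambda>x. S f x + c * S g x) \<in> Hcut \<alpha>"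
      using S_H(1)[OF f] S_H(1)[OF g] Hspace_add(1)[OF \<alpha> HS(1) Hspace_cmult(1)[OF \<alpha> HS(2)]]
      by (simp add: Hcut_def)
    moreover have "T (\<lambda>x. S f x + c * S g x) z - \<mu> * (S f z + c * S g z) = f z + c * g z"
      if "z \<in> disk" for z
      unfolding D(2)[OF HS that] S_H(2)[OF f that, symmetric] S_H(2)[OF g that, symmetric]
      by (simp add: algebra_simps)
    ultimately have "R (\<lambda>x. f x + c * g x) (\<lambda>x. S f x + c * S g x)" by (simp add: R_def)
    then show "S (\<lambda>x. f x + c * g x) z = S f z + c * S g z" using S_eqI[OF H] by simp
  next
    show "\<exists>C. \<forall>f\<in>Hspace \<alpha>. Hnorm \<alpha> (S f) \<le> C * Hnorm \<alpha> f"
    proof (intro exI ballI)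
      fix f assume f: "f \<in> Hspace \<alpha>"
      have "Hnorm \<alpha> (E.shift \<mu> (S f)) = Hnorm \<alpha> f"
        by (intro Hspace_cong(2)[OF \<alpha> f]) (simp add: shift S_H(2)[OF f])
      then have "c * Hnorm \<alpha> (S f) \<le> Hnorm \<alpha> f" using c(2)[OF S_H(1)[OF f]] by simp
      then show "Hnorm \<alpha> (S f) \<le> (1 / c) * Hnorm \<alpha> f" using c(1) by (simp add: field_simps)
    qed
  qed
  moreover have "S (\<lambda>x. T f x - \<mu> * f x) z = f z" if f: "f \<in> Hspace \<alpha>" and z: "z \<in> disk" for f z
  proof -
    \<comment> \<open>f itself need not lie in \<open>Hcut\<close>, so the preimage is
      \<open>cut f\<close>, on which \<open>T\<close> agrees with \<open>T f\<close> only on the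
      disk.\<close>
    have "T (cut f) z - \<mu> * cut f z = T f z - \<mu> * f z" if z: "z \<in> disk" for z
      using bounded_op_cong[OF \<alpha> b Hcut_in_Hspace[OF cut_in_Hcut(1)[OF \<alpha> f]] f _ z] z by (simp add: cut_def)
    then have "R (\<lambda>x. T f x - \<mu> * f x) (cut f)" using cut_in_Hcut(1)[OF \<alpha> f] by (simp add: R_def)
    moreover have "(\<lambda>x. T f x - \<mu> * f x) \<in> Hspace \<alpha>"
      using Hspace_add(1)[OF \<alpha> D(1)[OF f] Hspace_cmult(1)[OF \<alpha> f, of "-\<mu>"]] by simp
    ultimately have "S (\<lambda>x. T f x - \<mu> * f x) = cut f" by (intro S_eqI)
    then show ?thesis using z by (simp add: cut_def)
  qed
  ultimately show ?thesis unfolding spec_def using S_H(2) by blast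
qed

lemma spec_Cop_Dop:
  assumes \<alpha>: "\<alpha> \<ge> -1"
    and \<psi>: "\<psi>0 holomorphic_on disk" "\<psi>n holomorphic_on disk" "\<And>j. j < n \<Longrightarrow> (deriv ^^ j) \<psi>n w = 0"
    and \<phi>: "self_map \<phi>0" "self_map \<phi>n" "\<phi>0 w = w" "\<phi>n w = w" and w: "w \<in> disk"
    and T: "compact_op \<alpha> (\<lambda>f z. Cop \<psi>0 \<phi>0 f z + Dop \<psi>n \<phi>n n f z)"
  shows "spec \<alpha> (\<lambda>f z. Cop \<psi>0 \<phi>0 f z + Dop \<psi>n \<phi>n n f z) =
    {0} \<union> range (eigenval (\<psi>0 w) (deriv \<phi>0 w) ((deriv ^^ n) \<psi>n w) (deriv \<phi>n w) n)"
    (is "spec \<alpha> ?T = {0} \<union> range ?ev")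
proof -
  have lead: "has_leading disk w l (?ev l * c) (?T f)" if "has_leading disk w l c f" for l c f
    using has_leading_Cop_Dop[OF open_ball w that \<psi>] \<phi> by (simp add: self_map_def)
  have "\<mu> \<in> spec \<alpha> ?T" if "\<mu> \<in> range ?ev" for \<mu>
  proof (rule ccontr)
    assume "\<mu> \<notin> spec \<alpha> ?T"
    then obtain S where S: "bounded_op \<alpha> S"
      "\<And>g z. g \<in> Hspace \<alpha> \<Longrightarrow> z \<in> disk \<Longrightarrow> ?T (S g) z - \<mu> * S g z = g z"
      unfolding spec_def by auto
    define l where "l = (LEAST l. ?ev l = \<mu>)"
    have l: "?ev l = \<mu>" unfolding l_def using that by (auto intro: LeastI)
    have less: "?ev k \<noteq> \<mu>" if "k < l" for k using not_less_Least that unfolding l_def by blast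
    define f where "f = S (\<lambda>z. (z - w) ^ l)"
    have f: "f \<in> Hspace \<alpha>" unfolding f_def by (rule bounded_opD(1)[OF S(1) Hspace_power[OF \<alpha>]])
    have eq: "(z - w) ^ l = ?T f z + (-\<mu>) * f z" if "z \<in> disk" for z
      using S(2)[OF Hspace_power[OF \<alpha>] that] unfolding f_def by simp
    \<comment> \<open>A leading coefficient c of f at order k determines that of
      \<open>(z - w)^l\<close> at order k; uniqueness compares it with 0 for k < l and with 1 for k
      = l.\<close>
    have lead': "has_leading disk w k ((?ev k - \<mu>) * c) (\<lambda>z. (z - w) ^ l)" if "has_leading disk w k c f" for k c
      using has_leading_cong[OF has_leading_add[OF lead[OF that] has_leading_cmult[OF that, of "-\<mu>"]] eq]
      by (simp add: algebra_simps)
    \<comment> \<open>Each step raises the order of f by one: below l the factor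
      \<open>?ev k - \<mu>\<close> is nonzero, so the coefficient c must vanish.\<close>
    have "k \<le> l \<Longrightarrow> \<exists>c. has_leading disk w k c f" for k
    proof (induction k)
      case 0
      then show ?case using has_leading_0[OF Hspace_holomorphic[OF f]] by blast
    next
      case (Suc k)
      then obtain c where c: "has_leading disk w k c f" by auto
      have "(?ev k - \<mu>) * c = 0"
        using has_leading_unique[OF open_ball w lead'[OF c] has_leading_weaken[OF has_leading_power]] Suc.prems
        by simp
      then have "c = 0" using less[of k] Suc.prems by simp
      then show ?case using has_leading_Suc[OF open_ball w] c by metis
    qed
    then obtain c where "has_leading disk w l c f" by blast
    then have "(?ev l - \<mu>) * c = 1" using has_leading_unique[OF open_ball w lead' has_leading_power] by blast
    then show False using l by simp
  qed
  moreover have "\<mu> \<notin> spec \<alpha> ?T" if \<mu>: "\<mu> \<noteq> 0" "\<mu> \<notin> range ?ev" for \<mu>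
  proof (rule not_in_spec[OF \<alpha> T \<mu>(1)], rule ccontr)
    fix f z assume f: "f \<in> Hspace \<alpha>" and eq: "\<And>z. z \<in> disk \<Longrightarrow> ?T f z = \<mu> * f z"
      and z: "z \<in> disk" "f z \<noteq> 0"
    \<comment> \<open>An eigenfunction has finite order l, and comparing coefficients of order l
      makes its eigenvalue the l-th diagonal entry.\<close>
    obtain l c where lc: "has_leading disk w l c f" "c \<noteq> 0"
      using has_leading_exists[OF open_ball connected_ball w Hspace_holomorphic[OF f] z] .
    have "has_leading disk w l (\<mu> * c) (?T f)"
      using has_leading_cong[OF has_leading_cmult[OF lc(1)] eq] .
    then have "?ev l * c = \<mu> * c" using has_leading_unique[OF open_ball w lead[OF lc(1)]] by blast
    then show False using lc(2) \<mu>(2) by auto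
  qed
  ultimately show ?thesis using zero_in_spec[OF \<alpha> T] by blast
qed

lemma range_eigenval:
  assumes "n \<ge> 1"
  shows "range (eigenval a b c d n) = {a} \<union> {a * b ^ l | l. 1 \<le> l \<and> l \<le> n - 1} \<union>
    {a * b ^ l + of_nat (l choose n) * c * d ^ (l - n) | l. l \<ge> n}" (is "_ = ?R")
proof
  show "range (eigenval a b c d n) \<subseteq> ?R"
  proof
    fix x assume "x \<in> range (eigenval a b c d n)"
    then obtain l where l: "x = eigenval a b c d n l" by blast
    show "x \<in> ?R"
    proof (cases "l < n")
      case True
      \<comment> \<open>The exponent l = 0 is split off because \<open>\<psi>0 w\<close> is listed
        separately in the target set.\<close>
      then show ?thesis using l by (cases "l = 0") (auto simp: eigenval_def intro!: exI[of _ l])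
    next
      case False
      then show ?thesis using l by (auto simp: eigenval_def)
    qed
  qed
  have "a = eigenval a b c d n 0" using assms by (simp add: eigenval_def)
  moreover have "a * b ^ l = eigenval a b c d n l" if "1 \<le> l" "l \<le> n - 1" for l
    using that assms by (simp add: eigenval_def)
  moreover have "a * b ^ l + of_nat (l choose n) * c * d ^ (l - n) = eigenval a b c d n l" if "l \<ge> n" for l
    using that by (simp add: eigenval_def)
  ultimately show "?R \<subseteq> range (eigenval a b c d n)" by blast
qed

theorem theorem2p4:
  fixes \<alpha> :: real and n :: nat
  assumes "\<alpha> \<ge> -1" and "n \<ge> 1"
  shows "(\<forall>\<psi>0 \<psi>n \<phi>0 \<phi>n w.
            \<psi>0 holomorphic_on ball 0 1 \<and> \<psi>n holomorphic_on ball 0 1 \<and>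
            self_map \<phi>0 \<and> self_map \<phi>n \<and>
            bounded_op \<alpha> (Cop \<psi>0 \<phi>0) \<and> bounded_op \<alpha> (Dop \<psi>n \<phi>n n) \<and>
            w \<in> ball 0 1 \<and> \<phi>0 w = w \<and> \<phi>n w = w \<and>
            (\<forall>j<n. (deriv ^^ j) \<psi>n w = 0) \<and>
            compact_op \<alpha> (\<lambda>f z. Cop \<psi>0 \<phi>0 f z + Dop \<psi>n \<phi>n n f z)
          \<longrightarrow> spec \<alpha> (\<lambda>f z. Cop \<psi>0 \<phi>0 f z + Dop \<psi>n \<phi>n n f z) =
                {0} \<union> {\<psi>0 w} \<union>
                {\<psi>0 w * (deriv \<phi>0 w) ^ l | l. 1 \<le> l \<and> l \<le> n - 1} \<union>
                {\<psi>0 w * (deriv \<phi>0 w) ^ l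
                   + of_nat (l choose n) * (deriv ^^ n) \<psi>n w * (deriv \<phi>n w) ^ (l - n) | l. l \<ge> n})
       \<and> (\<forall>\<psi>n \<phi>n w.
            \<psi>n holomorphic_on ball 0 1 \<and> self_map \<phi>n \<and>
            compact_op \<alpha> (Dop \<psi>n \<phi>n n) \<and>
            w \<in> ball 0 1 \<and> \<phi>n w = w \<and> (\<forall>j\<le>n. (deriv ^^ j) \<psi>n w = 0)
          \<longrightarrow> spec \<alpha> (Dop \<psi>n \<phi>n n) = {0})"
proof (intro conjI allI impI, goal_cases)
  case (1 \<psi>0 \<psi>n \<phi>0 \<phi>n w)
  then have "spec \<alpha> (\<lambda>f z. Cop \<psi>0 \<phi>0 f z + Dop \<psi>n \<phi>n n f z) =
    {0} \<union> range (eigenval (\<psi>0 w) (deriv \<phi>0 w) ((deriv ^^ n) \<psi>n w) (deriv \<phi>n w) n)"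
    by (intro spec_Cop_Dop assms(1)) simp_all
  then show ?case unfolding range_eigenval[OF assms(2)] by (simp only: Un_assoc)
next
  case (2 \<psi>n \<phi>n w)
  \<comment> \<open>The identity is a self-map fixing w, so \<open>Dop\<close> alone is the sum with
    the zero weight and this map; every diagonal entry is then 0.\<close>
  have T: "(\<lambda>f z. Cop (\<lambda>_. 0) (\<lambda>z. z) f z + Dop \<psi>n \<phi>n n f z) = Dop \<psi>n \<phi>n n"
    by (simp add: Cop_def)
  have "spec \<alpha> (\<lambda>f z. Cop (\<lambda>_. 0) (\<lambda>z. z) f z + Dop \<psi>n \<phi>n n f z) =
    {0} \<union> range (eigenval 0 (deriv (\<lambda>z. z) w) ((deriv ^^ n) \<psi>n w) (deriv \<phi>n w) n)"
    using 2 by (intro spec_Cop_Dop assms(1)) (simp_all add: T self_map_def)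
  then show ?case unfolding T using 2 by (auto simp: eigenval_def)
qed

end
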